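(* Let $(W,S)$ be a finite Coxeter group, $(\mathcal{C}_w)_{w\in W}$ abelian categories with a $W$-gluing data $\Phi$, $J\subset S$ a subset and $W_Jx\subset W$ a coset of the parabolic subgroup $W_J$. Then the functor $j_{W_Jx,!}:\mathcal{C}(\Phi_{W_Jx})\to\mathcal{C}(\Phi)$ is left adjoint to the restriction functor $j^*_{W_Jx}:\mathcal{C}(\Phi)\to\mathcal{C}(\Phi_{W_Jx})$.
   Context: A $W$-gluing data $\Phi$ consists of right-exact functors $\Phi_w:\mathcal{C}_{w'}\to\mathcal{C}_{ww'}$ for all $w,w'\in W$ (same symbol for all $w'$), with $\Phi_1=\mathrm{Id}$, and morphisms of functors $\nu_{w,w'}:\Phi_w\Phi_{w'}\to\Phi_{ww'}$ (on each $\mathcal{C}_{w''}$) with $\nu_{1,w}=\nu_{w,1}=\mathrm{id}$, satisfying associativity $\nu_{ww',w''}\circ(\nu_{w,w'}\Phi_{w''})=\nu_{w,w'w''}\circ(\Phi_w\nu_{w',w''})$, and such that $\nu_{w,w'}$ is an isomorphism whenever $\ell(ww')=\ell(w)+\ell(w')$. For $P\subset W$, $\mathcal{C}(\Phi_P)$ is the abelian category of collections $(A_w,w\in P;\alpha_{w,w'})$ with $A_w\in\mathcal{C}_w$ and morphisms $\alpha_{w,w'}:\Phi_wA_{w'}\to A_{ww'}$ for $w',ww'\in P$, with $\alpha_{1,w'}=\mathrm{id}$ and $\alpha_{w_1,w_2w'}\circ\Phi_{w_1}(\alpha_{w_2,w'})=\alpha_{w_1w_2,w'}\circ\nu_{w_1,w_2}$;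 morphisms are componentwise and compatible with $\alpha$. $\mathcal{C}(\Phi)=\mathcal{C}(\Phi_W)$, and $j_P^*:\mathcal{C}(\Phi)\to\mathcal{C}(\Phi_P)$ is the obvious restriction functor. $W_J$ is the subgroup generated by $J$. For $w\in W$ let $p(w)$ be the unique element of $W_Jx$ such that $n(w):=wp(w)^{-1}$ has minimal possible length; $n(w)$ is the shortest element of the coset $wx^{-1}W_J$, and $\ell(n(w)w_1)=\ell(n(w))+\ell(w_1)$ for all $w_1\in W_J$. For $A=(A_w,w\in W_Jx;\alpha_{w,w'})$ define $j_{W_Jx,!}A=(A_w,w\in W;\alpha_{w,w'})$ by $A_w=\Phi_{n(w)}A_{p(w)}$, with $\alpha_{w,w'}$ the following composition: write $p(ww')=w_1p(w')$ with $w_1\in W_J$, so that $wn(w')=n(ww')w_1$, and take $$\Phi_w\Phi_{n(w')}A_{p(w')}\xrightarrow{\nu}\Phi_{wn(w')}A_{p(w')}\simeq\Phi_{n(ww')}\Phi_{w_1}A_{p(w')}\xrightarrow{\Phi_{n(ww')}(\alpha_{w_1,p(w')})}\Phi_{n(ww')}A_{p(ww')}.$$ This is an object of $\mathcal{C}(\Phi)$, and $j_{W_Jx,!}$ acts on morphisms by $(f_w)\mapsto(\Phi_{n(w)}(f_{p(w)}))$. *)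

theory Defs
  imports "HOL-Algebra.Multiplicative_Group" "HOL-Algebra.Generated_Groups"
begin

section \<open>Categories, abelian categories, functors, adjunctions\<close>

text \<open>
  A category carries chosen additions and zero morphisms on its Hom-sets; only
  preadditive categories impose laws on these two fields.
\<close>

record ('o, 'a) cat_data =
  Obj :: "'o set"
  Arr :: "'a set"
  Dom :: "'a \<Rightarrow> 'o"
  Cod :: "'a \<Rightarrow> 'o"
  Idn :: "'o \<Rightarrow> 'a"
  Cmp :: "'a \<Rightarrow> 'a \<Rightarrow> 'a"  (infixl "\<cdot>\<index>" 70)
  Add :: "'a \<Rightarrow> 'a \<Rightarrow> 'a"
  Zero :: "'o \<Rightarrow> 'o \<Rightarrow> 'a"

definition Hom :: "('o, 'a) cat_data \<Rightarrow> 'o \<Rightarrow> 'o \<Rightarrow> 'a set" where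
  "Hom C X Y = {f \<in> Arr C. Dom C f = X \<and> Cod C f = Y}"

locale category =
  fixes C :: "('o, 'a) cat_data" (structure)
  assumes dom_closed: "f \<in> Arr C \<Longrightarrow> Dom C f \<in> Obj C"
    and cod_closed: "f \<in> Arr C \<Longrightarrow> Cod C f \<in> Obj C"
    and idn_closed: "X \<in> Obj C \<Longrightarrow> Idn C X \<in> Hom C X X"
    and cmp_closed: "\<lbrakk>f \<in> Hom C X Y; g \<in> Hom C Y Z\<rbrakk> \<Longrightarrow> g \<cdot> f \<in> Hom C X Z"
    and cmp_assoc:
      "\<lbrakk>f \<in> Hom C X Y; g \<in> Hom C Y Z; h \<in> Hom C Z V\<rbrakk> \<Longrightarrow> (h \<cdot> g) \<cdot> f = h \<cdot> (g \<cdot> f)"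
    and cmp_idn_left: "f \<in> Hom C X Y \<Longrightarrow> Idn C Y \<cdot> f = f"
    and cmp_idn_right: "f \<in> Hom C X Y \<Longrightarrow> f \<cdot> Idn C X = f"

definition is_inverse :: "('o, 'a) cat_data \<Rightarrow> 'a \<Rightarrow> 'a \<Rightarrow> bool" where
  "is_inverse C f g \<longleftrightarrow> f \<in> Arr C \<and> g \<in> Hom C (Cod C f) (Dom C f) \<and>
     g \<cdot>\<^bsub>C\<^esub> f = Idn C (Dom C f) \<and> f \<cdot>\<^bsub>C\<^esub> g = Idn C (Cod C f)"

definition is_iso :: "('o, 'a) cat_data \<Rightarrow> 'a \<Rightarrow> bool" where
  "is_iso C f \<longleftrightarrow> (\<exists>g. is_inverse C f g)"

definition inverse_arr :: "('o, 'a) cat_data \<Rightarrow> 'a \<Rightarrow> 'a" where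
  "inverse_arr C f = (THE g. is_inverse C f g)"

definition is_monic :: "('o, 'a) cat_data \<Rightarrow> 'a \<Rightarrow> bool" where
  "is_monic C m \<longleftrightarrow> m \<in> Arr C \<and>
     (\<forall>X. \<forall>g \<in> Hom C X (Dom C m). \<forall>h \<in> Hom C X (Dom C m). m \<cdot>\<^bsub>C\<^esub> g = m \<cdot>\<^bsub>C\<^esub> h \<longrightarrow> g = h)"

definition is_epic :: "('o, 'a) cat_data \<Rightarrow> 'a \<Rightarrow> bool" where
  "is_epic C e \<longleftrightarrow> e \<in> Arr C \<and>
     (\<forall>Y. \<forall>g \<in> Hom C (Cod C e) Y. \<forall>h \<in> Hom C (Cod C e) Y. g \<cdot>\<^bsub>C\<^esub> e = h \<cdot>\<^bsub>C\<^esub> e \<longrightarrow> g = h)"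

definition is_zero_object :: "('o, 'a) cat_data \<Rightarrow> 'o \<Rightarrow> bool" where
  "is_zero_object C Z \<longleftrightarrow> Z \<in> Obj C \<and>
     (\<forall>X \<in> Obj C. (\<exists>!f. f \<in> Hom C X Z) \<and> (\<exists>!f. f \<in> Hom C Z X))"

definition is_kernel :: "('o, 'a) cat_data \<Rightarrow> 'a \<Rightarrow> 'a \<Rightarrow> bool" where
  "is_kernel C f k \<longleftrightarrow> f \<in> Arr C \<and> k \<in> Arr C \<and> Cod C k = Dom C f \<and>
     f \<cdot>\<^bsub>C\<^esub> k = Zero C (Dom C k) (Cod C f) \<and>
     (\<forall>X. \<forall>g \<in> Hom C X (Dom C f). f \<cdot>\<^bsub>C\<^esub> g = Zero C X (Cod C f) \<longrightarrow>
        (\<exists>!h. h \<in> Hom C X (Dom C k) \<and> k \<cdot>\<^bsub>C\<^esub> h = g))"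

definition is_cokernel :: "('o, 'a) cat_data \<Rightarrow> 'a \<Rightarrow> 'a \<Rightarrow> bool" where
  "is_cokernel C f q \<longleftrightarrow> f \<in> Arr C \<and> q \<in> Arr C \<and> Dom C q = Cod C f \<and>
     q \<cdot>\<^bsub>C\<^esub> f = Zero C (Dom C f) (Cod C q) \<and>
     (\<forall>Y. \<forall>g \<in> Hom C (Cod C f) Y. g \<cdot>\<^bsub>C\<^esub> f = Zero C (Dom C f) Y \<longrightarrow>
        (\<exists>!h. h \<in> Hom C (Cod C q) Y \<and> h \<cdot>\<^bsub>C\<^esub> q = g))"

definition is_biproduct ::
  "('o, 'a) cat_data \<Rightarrow> 'o \<Rightarrow> 'o \<Rightarrow> 'o \<Rightarrow> 'a \<Rightarrow> 'a \<Rightarrow> 'a \<Rightarrow> 'a \<Rightarrow> bool" where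
  "is_biproduct C X Y B i1 i2 p1 p2 \<longleftrightarrow> B \<in> Obj C \<and>
     i1 \<in> Hom C X B \<and> i2 \<in> Hom C Y B \<and> p1 \<in> Hom C B X \<and> p2 \<in> Hom C B Y \<and>
     p1 \<cdot>\<^bsub>C\<^esub> i1 = Idn C X \<and> p2 \<cdot>\<^bsub>C\<^esub> i2 = Idn C Y \<and>
     p1 \<cdot>\<^bsub>C\<^esub> i2 = Zero C Y X \<and> p2 \<cdot>\<^bsub>C\<^esub> i1 = Zero C X Y \<and>
     Add C (i1 \<cdot>\<^bsub>C\<^esub> p1) (i2 \<cdot>\<^bsub>C\<^esub> p2) = Idn C B"

definition hom_group :: "('o, 'a) cat_data \<Rightarrow> 'o \<Rightarrow> 'o \<Rightarrow> 'a monoid" where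
  "hom_group C X Y = \<lparr>carrier = Hom C X Y, monoid.mult = Add C, one = Zero C X Y\<rparr>"

locale preadditive_category = category +
  assumes hom_comm_group: "\<lbrakk>X \<in> Obj C; Y \<in> Obj C\<rbrakk> \<Longrightarrow> comm_group (hom_group C X Y)"
    and cmp_add_left: "\<lbrakk>f \<in> Hom C X Y; g \<in> Hom C Y Z; g' \<in> Hom C Y Z\<rbrakk>
      \<Longrightarrow> Add C g g' \<cdot> f = Add C (g \<cdot> f) (g' \<cdot> f)"
    and cmp_add_right: "\<lbrakk>f \<in> Hom C X Y; f' \<in> Hom C X Y; g \<in> Hom C Y Z\<rbrakk>
      \<Longrightarrow> g \<cdot> Add C f f' = Add C (g \<cdot> f) (g \<cdot> f')"

locale abelian_category = preadditive_category +
  assumes has_zero_object: "\<exists>Z. is_zero_object C Z"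
    and has_biproducts: "\<lbrakk>X \<in> Obj C; Y \<in> Obj C\<rbrakk>
      \<Longrightarrow> \<exists>B i1 i2 p1 p2. is_biproduct C X Y B i1 i2 p1 p2"
    and has_kernels: "f \<in> Arr C \<Longrightarrow> \<exists>k. is_kernel C f k"
    and has_cokernels: "f \<in> Arr C \<Longrightarrow> \<exists>q. is_cokernel C f q"
    and monic_normal: "is_monic C m \<Longrightarrow> \<exists>f. is_kernel C f m"
    and epic_normal: "is_epic C e \<Longrightarrow> \<exists>f. is_cokernel C f e"

record ('o, 'a, 'p, 'b) functor_data =
  FObj :: "'o \<Rightarrow> 'p"
  FArr :: "'a \<Rightarrow> 'b"

locale is_functor = source: category C + target: category D
  for C :: "('o, 'a) cat_data" and D :: "('p, 'b) cat_data" +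
  fixes F :: "('o, 'a, 'p, 'b) functor_data"
  assumes obj_closed: "X \<in> Obj C \<Longrightarrow> FObj F X \<in> Obj D"
    and arr_closed: "f \<in> Hom C X Y \<Longrightarrow> FArr F f \<in> Hom D (FObj F X) (FObj F Y)"
    and map_idn: "X \<in> Obj C \<Longrightarrow> FArr F (Idn C X) = Idn D (FObj F X)"
    and map_cmp: "\<lbrakk>f \<in> Hom C X Y; g \<in> Hom C Y Z\<rbrakk>
      \<Longrightarrow> FArr F (g \<cdot>\<^bsub>C\<^esub> f) = FArr F g \<cdot>\<^bsub>D\<^esub> FArr F f"

text \<open>
  A sequence X \<open>\<rightarrow>\<close> Y \<open>\<rightarrow>\<close> Z \<open>\<rightarrow>\<close> 0 in an abelian category is exact iff its second morphism is a
  cokernel of the first, so right exactness is additivity plus preservation of cokernels.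
\<close>

locale right_exact_functor = is_functor +
  assumes map_add: "\<lbrakk>f \<in> Hom C X Y; g \<in> Hom C X Y\<rbrakk>
      \<Longrightarrow> FArr F (Add C f g) = Add D (FArr F f) (FArr F g)"
    and map_cokernel: "is_cokernel C f q \<Longrightarrow> is_cokernel D (FArr F f) (FArr F q)"

definition left_adjoint ::
  "('o, 'a) cat_data \<Rightarrow> ('p, 'b) cat_data \<Rightarrow>
   ('o, 'a, 'p, 'b) functor_data \<Rightarrow> ('p, 'b, 'o, 'a) functor_data \<Rightarrow> bool" where
  "left_adjoint C D F G \<longleftrightarrow> is_functor C D F \<and> is_functor D C G \<and>
     (\<exists>\<phi>.
        (\<forall>X \<in> Obj C. \<forall>Y \<in> Obj D.
           bij_betw (\<phi> X Y) (Hom D (FObj F X) Y) (Hom C X (FObj G Y))) \<and>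
        (\<forall>X \<in> Obj C. \<forall>X' \<in> Obj C. \<forall>Y \<in> Obj D. \<forall>Y' \<in> Obj D.
           \<forall>f \<in> Hom C X' X. \<forall>g \<in> Hom D Y Y'. \<forall>h \<in> Hom D (FObj F X) Y.
             \<phi> X' Y' (g \<cdot>\<^bsub>D\<^esub> h \<cdot>\<^bsub>D\<^esub> FArr F f) = FArr G g \<cdot>\<^bsub>C\<^esub> \<phi> X Y h \<cdot>\<^bsub>C\<^esub> f))"


section \<open>Coxeter systems\<close>

definition word_prod :: "('w, 'r) monoid_scheme \<Rightarrow> 'w list \<Rightarrow> 'w" where
  "word_prod W ws = foldr (\<lambda>s w. s \<otimes>\<^bsub>W\<^esub> w) ws \<one>\<^bsub>W\<^esub>"

text \<open>
  The congruence on words generated by the relations \<open>(st)\<^sup>m = 1\<close>, where m is the order of st.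
  An infinite order is encoded as 0, which gives the empty relation.  For involutive generators
  the case s = t yields the relation ss = 1, so words without formal inverses suffice.
\<close>

inductive coxeter_equiv :: "('w, 'r) monoid_scheme \<Rightarrow> 'w set \<Rightarrow> 'w list \<Rightarrow> 'w list \<Rightarrow> bool"
  for W (structure) and S where
  relation: "\<lbrakk>set u \<subseteq> S; set v \<subseteq> S; s \<in> S; t \<in> S\<rbrakk>
    \<Longrightarrow> coxeter_equiv W S (u @ concat (replicate (group.ord W (s \<otimes> t)) [s, t]) @ v) (u @ v)"
| refl: "set u \<subseteq> S \<Longrightarrow> coxeter_equiv W S u u"
| sym: "coxeter_equiv W S u v \<Longrightarrow> coxeter_equiv W S v u"
| trans: "\<lbrakk>coxeter_equiv W S u v; coxeter_equiv W S v w\<rbrakk> \<Longrightarrow> coxeter_equiv W S u w"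

text \<open>The last assumption says that these relations present W on the generators S.\<close>

locale coxeter_system = group W for W (structure) +
  fixes S
  assumes gens_closed: "S \<subseteq> carrier W"
    and gens_generate: "generate W S = carrier W"
    and gens_order_two: "s \<in> S \<Longrightarrow> ord s = 2"
    and presentation: "\<lbrakk>set u \<subseteq> S; set v \<subseteq> S; word_prod W u = word_prod W v\<rbrakk>
      \<Longrightarrow> coxeter_equiv W S u v"

definition cox_length :: "('w, 'r) monoid_scheme \<Rightarrow> 'w set \<Rightarrow> 'w \<Rightarrow> nat" where
  "cox_length W S w = (LEAST k. \<exists>ws. set ws \<subseteq> S \<and> word_prod W ws = w \<and> length ws = k)"


section \<open>Gluing data and glued categories\<close>

text \<open>
  \<open>\<Phi> w w'\<close> is the functor \<open>\<Phi>\<^sub>w\<close> from \<open>C w'\<close> to \<open>C (w \<otimes> w')\<close>; \<open>\<nu> w w' w'' A\<close> is the component at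
  an object A of \<open>C w''\<close> of the morphism of functors from \<open>\<Phi>\<^sub>w\<Phi>\<^sub>w\<^sub>'\<close> to \<open>\<Phi>\<^sub>w\<^sub>w\<^sub>'\<close>.
\<close>

locale gluing_data = group W for W :: "('w, 'r) monoid_scheme" (structure) +
  fixes S :: "'w set"
    and C :: "'w \<Rightarrow> ('o, 'a) cat_data"
    and \<Phi> :: "'w \<Rightarrow> 'w \<Rightarrow> ('o, 'a, 'o, 'a) functor_data"
    and \<nu> :: "'w \<Rightarrow> 'w \<Rightarrow> 'w \<Rightarrow> 'o \<Rightarrow> 'a"
  assumes Phi_right_exact: "\<lbrakk>w \<in> carrier W; w' \<in> carrier W\<rbrakk>
      \<Longrightarrow> right_exact_functor (C w') (C (w \<otimes> w')) (\<Phi> w w')"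
    and Phi_one_obj: "\<lbrakk>w' \<in> carrier W; A \<in> Obj (C w')\<rbrakk> \<Longrightarrow> FObj (\<Phi> \<one> w') A = A"
    and Phi_one_arr: "\<lbrakk>w' \<in> carrier W; f \<in> Arr (C w')\<rbrakk> \<Longrightarrow> FArr (\<Phi> \<one> w') f = f"
    and nu_closed: "\<lbrakk>w \<in> carrier W; w' \<in> carrier W; w'' \<in> carrier W; A \<in> Obj (C w'')\<rbrakk>
      \<Longrightarrow> \<nu> w w' w'' A \<in> Hom (C (w \<otimes> w' \<otimes> w''))
            (FObj (\<Phi> w (w' \<otimes> w'')) (FObj (\<Phi> w' w'') A)) (FObj (\<Phi> (w \<otimes> w') w'') A)"
    and nu_natural: "\<lbrakk>w \<in> carrier W; w' \<in> carrier W; w'' \<in> carrier W; f \<in> Hom (C w'') A B\<rbrakk>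
      \<Longrightarrow> \<nu> w w' w'' B \<cdot>\<^bsub>C (w \<otimes> w' \<otimes> w'')\<^esub> FArr (\<Phi> w (w' \<otimes> w'')) (FArr (\<Phi> w' w'') f)
          = FArr (\<Phi> (w \<otimes> w') w'') f \<cdot>\<^bsub>C (w \<otimes> w' \<otimes> w'')\<^esub> \<nu> w w' w'' A"
    and nu_one_left: "\<lbrakk>w \<in> carrier W; w'' \<in> carrier W; A \<in> Obj (C w'')\<rbrakk>
      \<Longrightarrow> \<nu> \<one> w w'' A = Idn (C (w \<otimes> w'')) (FObj (\<Phi> w w'') A)"
    and nu_one_right: "\<lbrakk>w \<in> carrier W; w'' \<in> carrier W; A \<in> Obj (C w'')\<rbrakk>
      \<Longrightarrow> \<nu> w \<one> w'' A = Idn (C (w \<otimes> w'')) (FObj (\<Phi> w w'') A)"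
    and nu_assoc: "\<lbrakk>w \<in> carrier W; w' \<in> carrier W; w'' \<in> carrier W; v \<in> carrier W; A \<in> Obj (C v)\<rbrakk>
      \<Longrightarrow> \<nu> (w \<otimes> w') w'' v A \<cdot>\<^bsub>C (w \<otimes> w' \<otimes> w'' \<otimes> v)\<^esub> \<nu> w w' (w'' \<otimes> v) (FObj (\<Phi> w'' v) A)
          = \<nu> w (w' \<otimes> w'') v A \<cdot>\<^bsub>C (w \<otimes> w' \<otimes> w'' \<otimes> v)\<^esub> FArr (\<Phi> w (w' \<otimes> w'' \<otimes> v)) (\<nu> w' w'' v A)"
    and nu_iso: "\<lbrakk>w \<in> carrier W; w' \<in> carrier W; w'' \<in> carrier W; A \<in> Obj (C w'');
        cox_length W S (w \<otimes> w') = cox_length W S w + cox_length W S w'\<rbrakk>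
      \<Longrightarrow> is_iso (C (w \<otimes> w' \<otimes> w'')) (\<nu> w w' w'' A)"

definition glue_index :: "('w, 'r) monoid_scheme \<Rightarrow> 'w set \<Rightarrow> ('w \<times> 'w) set" where
  "glue_index W P = {(w, w'). w \<in> carrier W \<and> w' \<in> P \<and> w \<otimes>\<^bsub>W\<^esub> w' \<in> P}"

text \<open>
  An object is a pair of families (A, \<open>\<alpha>\<close>), a morphism a triple (source, target, components).
  Families are extensional: they are undefined outside their index sets.
\<close>

type_synonym ('w, 'o, 'a) glue_obj = "('w \<Rightarrow> 'o) \<times> ('w \<times> 'w \<Rightarrow> 'a)"
type_synonym ('w, 'o, 'a) glue_arr =
  "('w, 'o, 'a) glue_obj \<times> ('w, 'o, 'a) glue_obj \<times> ('w \<Rightarrow> 'a)"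

definition glue_objects :: "('w, 'r) monoid_scheme \<Rightarrow> ('w \<Rightarrow> ('o, 'a) cat_data) \<Rightarrow>
    ('w \<Rightarrow> 'w \<Rightarrow> ('o, 'a, 'o, 'a) functor_data) \<Rightarrow> ('w \<Rightarrow> 'w \<Rightarrow> 'w \<Rightarrow> 'o \<Rightarrow> 'a) \<Rightarrow>
    'w set \<Rightarrow> ('w, 'o, 'a) glue_obj set" where
  "glue_objects W C \<Phi> \<nu> P = {(A, \<alpha>).
     A \<in> extensional P \<and> \<alpha> \<in> extensional (glue_index W P) \<and>
     (\<forall>w \<in> P. A w \<in> Obj (C w)) \<and>
     (\<forall>(w, w') \<in> glue_index W P.
        \<alpha> (w, w') \<in> Hom (C (w \<otimes>\<^bsub>W\<^esub> w')) (FObj (\<Phi> w w') (A w')) (A (w \<otimes>\<^bsub>W\<^esub> w'))) \<and>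
     (\<forall>w' \<in> P. \<alpha> (\<one>\<^bsub>W\<^esub>, w') = Idn (C w') (A w')) \<and>
     (\<forall>w\<^sub>1 \<in> carrier W. \<forall>w\<^sub>2 \<in> carrier W. \<forall>w' \<in> P.
        w\<^sub>2 \<otimes>\<^bsub>W\<^esub> w' \<in> P \<longrightarrow> w\<^sub>1 \<otimes>\<^bsub>W\<^esub> w\<^sub>2 \<otimes>\<^bsub>W\<^esub> w' \<in> P \<longrightarrow>
        \<alpha> (w\<^sub>1, w\<^sub>2 \<otimes>\<^bsub>W\<^esub> w') \<cdot>\<^bsub>C (w\<^sub>1 \<otimes>\<^bsub>W\<^esub> w\<^sub>2 \<otimes>\<^bsub>W\<^esub> w')\<^esub> FArr (\<Phi> w\<^sub>1 (w\<^sub>2 \<otimes>\<^bsub>W\<^esub> w')) (\<alpha> (w\<^sub>2, w'))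
        = \<alpha> (w\<^sub>1 \<otimes>\<^bsub>W\<^esub> w\<^sub>2, w') \<cdot>\<^bsub>C (w\<^sub>1 \<otimes>\<^bsub>W\<^esub> w\<^sub>2 \<otimes>\<^bsub>W\<^esub> w')\<^esub> \<nu> w\<^sub>1 w\<^sub>2 w' (A w'))}"

definition glue_arrows :: "('w, 'r) monoid_scheme \<Rightarrow> ('w \<Rightarrow> ('o, 'a) cat_data) \<Rightarrow>
    ('w \<Rightarrow> 'w \<Rightarrow> ('o, 'a, 'o, 'a) functor_data) \<Rightarrow> ('w \<Rightarrow> 'w \<Rightarrow> 'w \<Rightarrow> 'o \<Rightarrow> 'a) \<Rightarrow>
    'w set \<Rightarrow> ('w, 'o, 'a) glue_arr set" where
  "glue_arrows W C \<Phi> \<nu> P = {((A, \<alpha>), (B, \<beta>), f).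
     (A, \<alpha>) \<in> glue_objects W C \<Phi> \<nu> P \<and> (B, \<beta>) \<in> glue_objects W C \<Phi> \<nu> P \<and>
     f \<in> extensional P \<and> (\<forall>w \<in> P. f w \<in> Hom (C w) (A w) (B w)) \<and>
     (\<forall>(w, w') \<in> glue_index W P.
        f (w \<otimes>\<^bsub>W\<^esub> w') \<cdot>\<^bsub>C (w \<otimes>\<^bsub>W\<^esub> w')\<^esub> \<alpha> (w, w')
        = \<beta> (w, w') \<cdot>\<^bsub>C (w \<otimes>\<^bsub>W\<^esub> w')\<^esub> FArr (\<Phi> w w') (f w'))}"

definition glue_cat :: "('w, 'r) monoid_scheme \<Rightarrow> ('w \<Rightarrow> ('o, 'a) cat_data) \<Rightarrow>
    ('w \<Rightarrow> 'w \<Rightarrow> ('o, 'a, 'o, 'a) functor_data) \<Rightarrow> ('w \<Rightarrow> 'w \<Rightarrow> 'w \<Rightarrow> 'o \<Rightarrow> 'a) \<Rightarrow>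
    'w set \<Rightarrow> (('w, 'o, 'a) glue_obj, ('w, 'o, 'a) glue_arr) cat_data" where
  "glue_cat W C \<Phi> \<nu> P = \<lparr>
     Obj = glue_objects W C \<Phi> \<nu> P,
     Arr = glue_arrows W C \<Phi> \<nu> P,
     Dom = (\<lambda>(X, Y, f). X),
     Cod = (\<lambda>(X, Y, f). Y),
     Idn = (\<lambda>X. (X, X, \<lambda>w \<in> P. Idn (C w) (fst X w))),
     Cmp = (\<lambda>(Y, Z, g) (X, Y', f). (X, Z, \<lambda>w \<in> P. g w \<cdot>\<^bsub>C w\<^esub> f w)),
     Add = (\<lambda>(X, Y, f) (X', Y', g). (X, Y, \<lambda>w \<in> P. Add (C w) (f w) (g w))),
     Zero = (\<lambda>X Y. (X, Y, \<lambda>w \<in> P. Zero (C w) (fst X w) (fst Y w)))\<rparr>"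

definition j_res_obj :: "('w, 'r) monoid_scheme \<Rightarrow> 'w set \<Rightarrow>
    ('w, 'o, 'a) glue_obj \<Rightarrow> ('w, 'o, 'a) glue_obj" where
  "j_res_obj W P X = (restrict (fst X) P, restrict (snd X) (glue_index W P))"

definition j_res :: "('w, 'r) monoid_scheme \<Rightarrow> 'w set \<Rightarrow>
    (('w, 'o, 'a) glue_obj, ('w, 'o, 'a) glue_arr,
     ('w, 'o, 'a) glue_obj, ('w, 'o, 'a) glue_arr) functor_data" where
  "j_res W P = \<lparr>
     FObj = j_res_obj W P,
     FArr = (\<lambda>(X, Y, f). (j_res_obj W P X, j_res_obj W P Y, restrict f P))\<rparr>"


section \<open>The extension functor from a coset\<close>

text \<open>In what follows P stands for a coset \<open>W\<^sub>Jx\<close>.\<close>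

definition coset_p :: "('w, 'r) monoid_scheme \<Rightarrow> 'w set \<Rightarrow> 'w set \<Rightarrow> 'w \<Rightarrow> 'w" where
  "coset_p W S P w = (THE p. p \<in> P \<and>
     (\<forall>q \<in> P. cox_length W S (w \<otimes>\<^bsub>W\<^esub> inv\<^bsub>W\<^esub> p) \<le> cox_length W S (w \<otimes>\<^bsub>W\<^esub> inv\<^bsub>W\<^esub> q)))"

definition coset_n :: "('w, 'r) monoid_scheme \<Rightarrow> 'w set \<Rightarrow> 'w set \<Rightarrow> 'w \<Rightarrow> 'w" where
  "coset_n W S P w = w \<otimes>\<^bsub>W\<^esub> inv\<^bsub>W\<^esub> (coset_p W S P w)"

text \<open>
  With \<open>w\<^sub>1 = p(ww')p(w')\<^sup>-\<^sup>1\<close> one has \<open>wn(w') = n(ww')w\<^sub>1\<close>; the isomorphism inverted below is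
  \<open>\<nu>\<close> for the length-additive product \<open>n(ww')w\<^sub>1\<close>.
\<close>

definition j_shriek_obj :: "('w, 'r) monoid_scheme \<Rightarrow> 'w set \<Rightarrow> ('w \<Rightarrow> ('o, 'a) cat_data) \<Rightarrow>
    ('w \<Rightarrow> 'w \<Rightarrow> ('o, 'a, 'o, 'a) functor_data) \<Rightarrow> ('w \<Rightarrow> 'w \<Rightarrow> 'w \<Rightarrow> 'o \<Rightarrow> 'a) \<Rightarrow>
    'w set \<Rightarrow> ('w, 'o, 'a) glue_obj \<Rightarrow> ('w, 'o, 'a) glue_obj" where
  "j_shriek_obj W S C \<Phi> \<nu> P X =
    (let A = fst X; \<alpha> = snd X; n = coset_n W S P; p = coset_p W S P in
      (\<lambda>w \<in> carrier W. FObj (\<Phi> (n w) (p w)) (A (p w)),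
       \<lambda>(w, w') \<in> glue_index W (carrier W).
         let u = w \<otimes>\<^bsub>W\<^esub> w'; w\<^sub>1 = p u \<otimes>\<^bsub>W\<^esub> inv\<^bsub>W\<^esub> (p w') in
           FArr (\<Phi> (n u) (p u)) (\<alpha> (w\<^sub>1, p w'))
           \<cdot>\<^bsub>C u\<^esub> inverse_arr (C u) (\<nu> (n u) w\<^sub>1 (p w') (A (p w')))
           \<cdot>\<^bsub>C u\<^esub> \<nu> w (n w') (p w') (A (p w'))))"

definition j_shriek :: "('w, 'r) monoid_scheme \<Rightarrow> 'w set \<Rightarrow> ('w \<Rightarrow> ('o, 'a) cat_data) \<Rightarrow>
    ('w \<Rightarrow> 'w \<Rightarrow> ('o, 'a, 'o, 'a) functor_data) \<Rightarrow> ('w \<Rightarrow> 'w \<Rightarrow> 'w \<Rightarrow> 'o \<Rightarrow> 'a) \<Rightarrow> 'w set \<Rightarrow>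
    (('w, 'o, 'a) glue_obj, ('w, 'o, 'a) glue_arr,
     ('w, 'o, 'a) glue_obj, ('w, 'o, 'a) glue_arr) functor_data" where
  "j_shriek W S C \<Phi> \<nu> P = \<lparr>
     FObj = j_shriek_obj W S C \<Phi> \<nu> P,
     FArr = (\<lambda>(X, Y, f).
       (j_shriek_obj W S C \<Phi> \<nu> P X, j_shriek_obj W S C \<Phi> \<nu> P Y,
        \<lambda>w \<in> carrier W.
          FArr (\<Phi> (coset_n W S P w) (coset_p W S P w)) (f (coset_p W S P w))))\<rparr>"

end

theory Submission
  imports Defs "HOL-Library.Sublist"
begin

text \<open>
  Restricting \<open>j\<^sub>!A\<close> back to the coset \<open>P = W\<^sub>Jx\<close> gives A itself: for w in P one has \<open>p(w) = w\<close> and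
  \<open>n(w) = 1\<close>, and both \<open>\<Phi>\<^sub>1\<close> and the morphisms \<open>\<nu>\<close> with an index 1 are identities (\<open>j_res_shriek_obj\<close>).  So the
  adjunction is simply restriction of morphisms, \<open>Hom(j\<^sub>!A, B) \<rightarrow> Hom(A, j\<^sup>*B)\<close>, and its naturality is the
  functoriality of restriction.

  Restriction is injective because the structure morphism of \<open>j\<^sub>!A\<close> at the pair \<open>(n(w), p(w))\<close> is an
  identity, so that the compatibility of a morphism h with this pair reads
  \<open>h w = \<beta> (n w, p w) \<cdot> \<Phi> (n w) (h (p w))\<close> (\<open>shriek_hom_component\<close>).  It is surjective because the same formula,
  read as a definition, extends any morphism \<open>A \<rightarrow> j\<^sup>*B\<close> (\<open>extend_hom\<close>).  That \<open>j\<^sub>!A\<close> is an object at all is a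
  diagram chase with the naturality and the cocycle condition of \<open>\<nu>\<close> (\<open>shriek_map_assoc\<close>).

  The structure morphisms of \<open>j\<^sub>!A\<close> contain inverses of \<open>\<nu>\<close> for the products of \<open>n(w)\<close> with elements of
  \<open>W\<^sub>J\<close>, and p must be well defined.  Both follow from the additivity of length on a minimal coset
  representative times \<open>W\<^sub>J\<close> (\<open>length_additive_if_minimal_in_coset\<close>), which is derived from the deletion
  property.  The latter is obtained from the presentation of W: the set of reflections that occur an
  odd number of times among the reflections attached to the letters of a word is invariant under the
  defining relations (\<open>reflection_parity_invariant\<close>), so a word that is longer than necessary has two
  letters with the same reflection, and these can be deleted together.
\<close>

section \<open>Deletion in Coxeter groups\<close>

context group
begin

lemma word_prod_simps [simp]:
  "word_prod G [] = \<one>" "word_prod G (s # ws) = s \<otimes> word_prod G ws"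
  by (simp_all add: word_prod_def)

lemma word_prod_closed [simp]: "set ws \<subseteq> carrier G \<Longrightarrow> word_prod G ws \<in> carrier G"
  by (induction ws) auto

lemma word_prod_append:
  "\<lbrakk>set us \<subseteq> carrier G; set vs \<subseteq> carrier G\<rbrakk>
    \<Longrightarrow> word_prod G (us @ vs) = word_prod G us \<otimes> word_prod G vs"
  by (induction us) (auto simp: m_assoc)

definition conj_by :: "'a \<Rightarrow> 'a \<Rightarrow> 'a" where
  "conj_by w t = w \<otimes> t \<otimes> inv w"

lemma conj_by_closed [simp]: "\<lbrakk>w \<in> carrier G; t \<in> carrier G\<rbrakk> \<Longrightarrow> conj_by w t \<in> carrier G"
  by (simp add: conj_by_def)

lemma conj_by_mult:
  "\<lbrakk>v \<in> carrier G; w \<in> carrier G; t \<in> carrier G\<rbrakk>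
    \<Longrightarrow> conj_by v (conj_by w t) = conj_by (v \<otimes> w) t"
  by (simp add: conj_by_def m_assoc inv_mult_group)

lemma conj_by_one [simp]: "t \<in> carrier G \<Longrightarrow> conj_by \<one> t = t"
  by (simp add: conj_by_def)

text \<open>
  For a word of involutions these are the conjugates \<open>s\<^sub>1 \<dots> s\<^sub>i\<^sub>-\<^sub>1 s\<^sub>i s\<^sub>i\<^sub>-\<^sub>1 \<dots> s\<^sub>1\<close>, one for each position i:
  multiplying the word from the left by the i-th of them deletes the letter \<open>s\<^sub>i\<close>.
\<close>

fun reflections :: "'a list \<Rightarrow> 'a list" where
  "reflections [] = []"
| "reflections (s # ws) = s # map (conj_by s) (reflections ws)"

lemma length_reflections [simp]: "length (reflections ws) = length ws"
  by (induction ws) auto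

lemma reflections_closed: "set ws \<subseteq> carrier G \<Longrightarrow> set (reflections ws) \<subseteq> carrier G"
  by (induction ws) auto

lemma reflections_append:
  assumes "set us \<subseteq> carrier G" "set vs \<subseteq> carrier G"
  shows "reflections (us @ vs) = reflections us @ map (conj_by (word_prod G us)) (reflections vs)"
  using assms
proof (induction us)
  case Nil
  then show ?case
    using reflections_closed[of vs] by (auto intro!: map_idI[symmetric])
next
  case (Cons s us)
  then show ?case
    using reflections_closed[of vs] by (auto simp: conj_by_mult)
qed

lemma reflections_dihedral:
  assumes "s \<in> carrier G" "t \<in> carrier G" "s \<otimes> s = \<one>" "t \<otimes> t = \<one>"
  shows "reflections (concat (replicate k [s, t]))
    = map (\<lambda>i. (s \<otimes> t) [^] i \<otimes> s) [0..<2 * k]"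
proof (induction k)
  case 0
  then show ?case by simp
next
  case (Suc k)
  have inv: "inv s = s" "inv t = t"
    using assms inv_equality by blast+
  have step: "conj_by (s \<otimes> t) ((s \<otimes> t) [^] i \<otimes> s) = (s \<otimes> t) [^] Suc (Suc i) \<otimes> s" for i :: nat
  proof -
    have "(s \<otimes> t) [^] Suc (Suc i) = (s \<otimes> t) \<otimes> (s \<otimes> t) [^] i \<otimes> (s \<otimes> t)"
      by (metis assms(1,2) m_closed nat_pow_Suc nat_pow_Suc2)
    then show ?thesis
      using assms by (simp add: conj_by_def inv_mult_group inv m_assoc)
  qed
  have upt: "[0..<2 * Suc k] = 0 # 1 # map (\<lambda>i. Suc (Suc i)) [0..<2 * k]"
    by (simp add: upt_conv_Cons map_Suc_upt[symmetric] del: upt_Suc)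
  have "set (reflections (concat (replicate k [s, t]))) \<subseteq> carrier G"
    using assms by (intro reflections_closed) (induction k, auto)
  then have "map (conj_by s) (map (conj_by t) (reflections (concat (replicate k [s, t]))))
    = map (conj_by (s \<otimes> t)) (reflections (concat (replicate k [s, t])))"
    using assms by (auto simp: conj_by_mult)
  also have "\<dots> = map (\<lambda>i. (s \<otimes> t) [^] Suc (Suc i) \<otimes> s) [0..<2 * k]"
    by (simp add: Suc step del: nat_pow_Suc)
  finally have "map (conj_by s) (map (conj_by t) (reflections (concat (replicate k [s, t]))))
    = map (\<lambda>i. (s \<otimes> t) [^] Suc (Suc i) \<otimes> s) [0..<2 * k]" .
  then show ?case
    using assms unfolding upt
    by (simp add: conj_by_def inv o_def del: nat_pow_Suc)
qed

end

context coxeter_system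
begin

lemma S_carrier: "s \<in> S \<Longrightarrow> s \<in> carrier W"
  using gens_closed by blast

lemma S_involution: "s \<in> S \<Longrightarrow> s \<otimes> s = \<one>"
  using pow_ord_eq_1[OF S_carrier] gens_order_two S_carrier by (fastforce simp: numeral_2_eq_2)

lemma S_inv: "s \<in> S \<Longrightarrow> inv s = s"
  using S_involution S_carrier inv_equality by blast

text \<open>
  The reflections of a relator \<open>(st)\<^sup>m\<close> are \<open>(st)\<^sup>is\<close> for \<open>0 \<le> i < 2m\<close>; since \<open>(st)\<^sup>m = 1\<close>, the second
  half of the list repeats the first half.  As the relator itself has product 1, it does not affect
  the reflections of the letters after it.
\<close>

lemma reflection_parity_invariant:
  "coxeter_equiv W S u v
    \<Longrightarrow> even (count_list (reflections u) r) = even (count_list (reflections v) r)"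
proof (induction rule: coxeter_equiv.induct)
  case (relation u v s t)
  define m where "m = ord (s \<otimes> t)"
  define z where "z = concat (replicate m [s, t])"
  have st: "s \<in> carrier W" "t \<in> carrier W" "s \<otimes> s = \<one>" "t \<otimes> t = \<one>"
    using relation S_carrier S_involution by auto
  have uv: "set u \<subseteq> carrier W" "set v \<subseteq> carrier W"
    using relation gens_closed by auto
  have pow: "(s \<otimes> t) [^] m = \<one>"
    unfolding m_def using st by (simp add: pow_ord_eq_1)
  have z: "set z \<subseteq> carrier W"
    unfolding z_def using st by (induction m) auto
  have "word_prod W (concat (replicate k [s, t])) = (s \<otimes> t) [^] k" for k
  proof (induction k)
    case (Suc k)
    then show ?case
      using st nat_pow_Suc2[of "s \<otimes> t" k] by (simp add: m_assoc del: nat_pow_Suc)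
  qed simp
  then have prod_z: "word_prod W z = \<one>"
    using pow by (simp add: z_def)
  \<comment> \<open>This splits the list of reflections of the relator into its two equal halves.\<close>
  have upt: "[0..<2 * m] = [0..<m] @ map (\<lambda>i. i + m) [0..<m]"
    by (simp add: map_add_upt mult_2 upt_add_eq_append[of 0 m m, simplified])
  have "(s \<otimes> t) [^] (i + m) = (s \<otimes> t) [^] i" for i :: nat
    using st pow nat_pow_mult[of "s \<otimes> t" i m] by simp
  then obtain L where L: "reflections z = L @ L"
    unfolding z_def reflections_dihedral[OF st] upt by (auto simp: o_def)
  have "set (z @ v) \<subseteq> carrier W"
    using z uv by simp
  moreover have "map (conj_by \<one>) (reflections v) = reflections v"
    using reflections_closed[OF uv(2)] by (auto intro!: map_idI)
  ultimately have "reflections (u @ z @ v) = reflections u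
      @ map (conj_by (word_prod W u)) (L @ L) @ map (conj_by (word_prod W u)) (reflections v)"
    using uv z by (simp only: reflections_append prod_z L map_append)
  moreover have "reflections (u @ v)
      = reflections u @ map (conj_by (word_prod W u)) (reflections v)"
    using uv by (simp add: reflections_append)
  ultimately show ?case
    by (auto simp: z_def m_def)
qed auto

text \<open>
  If two equal reflections sit at the letters s and t of \<open>a s b t c\<close>, then \<open>s b t = b\<close>, so both
  letters can be deleted.
\<close>

lemma delete_equal_reflections:
  assumes u: "set u \<subseteq> S" and rep: "\<not> distinct (reflections u)"
  obtains u' where "subseq u' u" "length u' < length u" "word_prod W u' = word_prod W u"
proof -
  obtain xs ys zs y where dec: "reflections u = xs @ [y] @ ys @ [y] @ zs"
    using not_distinct_decomp[OF rep] by blast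
  have len: "length u = length xs + 1 + length ys + 1 + length zs"
    using arg_cong[OF dec, of length] by simp
  define a where "a = take (length xs) u"
  define b where "b = take (length ys) (drop (length xs + 1) u)"
  define c where "c = drop (length xs + 1 + length ys + 1) u"
  define s where "s = u ! length xs"
  define t where "t = u ! (length xs + 1 + length ys)"
  have "u = a @ drop (length xs) u"
    by (simp add: a_def)
  also have "drop (length xs) u = s # drop (length xs + 1) u"
    using len by (simp add: s_def Cons_nth_drop_Suc)
  also have "drop (length xs + 1) u = b @ drop (length xs + 1 + length ys) u"
    unfolding b_def by (metis add.commute append_take_drop_id drop_drop)
  also have "drop (length xs + 1 + length ys) u = t # c"
    using len by (simp add: t_def c_def Cons_nth_drop_Suc)
  finally have u_eq: "u = a @ s # b @ t # c" .
  have lens: "length a = length xs" "length b = length ys"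
    using len by (simp_all add: a_def b_def)
  have cl: "set a \<subseteq> carrier W" "set b \<subseteq> carrier W" "set c \<subseteq> carrier W"
    and st: "s \<in> S" "t \<in> S"
    using u gens_closed u_eq by auto
  note scl = S_carrier[OF st(1)] S_carrier[OF st(2)]
  define pa where "pa = word_prod W a"
  define pb where "pb = word_prod W b"
  have p: "pa \<in> carrier W" "pb \<in> carrier W"
    using cl by (auto simp: pa_def pb_def)
  have cl': "set (t # c) \<subseteq> carrier W" "set (b @ t # c) \<subseteq> carrier W"
    "set (s # b @ t # c) \<subseteq> carrier W"
    using cl scl by auto
  have "reflections u ! length xs = y" "reflections u ! (length xs + 1 + length ys) = y"
    unfolding dec by (simp_all add: nth_append)
  moreover have "reflections u ! length xs = conj_by pa s"
    unfolding u_eq reflections_append[OF cl(1) cl'(3)]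
    using lens by (simp add: nth_append pa_def)
  moreover have "reflections u ! (length xs + 1 + length ys) = conj_by pa (conj_by s (conj_by pb t))"
    unfolding u_eq reflections_append[OF cl(1) cl'(3)] reflections.simps
      reflections_append[OF cl(2) cl'(1)]
    using lens by (simp add: nth_append pa_def pb_def)
  ultimately have "conj_by pa s = conj_by pa (conj_by s (conj_by pb t))"
    by simp
  then have "s = conj_by s (conj_by pb t)"
    using p scl by (simp add: conj_by_def)
  then have "s \<otimes> \<one> = s \<otimes> (pb \<otimes> t \<otimes> inv pb \<otimes> inv s)"
    using p scl by (simp add: conj_by_def m_assoc)
  then have "\<one> = pb \<otimes> t \<otimes> inv pb \<otimes> inv s"
    using p scl by (metis l_cancel_one' m_closed inv_closed r_one)
  then have "s \<otimes> pb = pb \<otimes> t"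
    using p scl by (metis inv_closed inv_equality inv_inv inv_solve_right m_closed)
  then have "s \<otimes> (pb \<otimes> t) = pb"
    using p scl S_involution st by (metis m_assoc r_one)
  then have "s \<otimes> (pb \<otimes> (t \<otimes> word_prod W c)) = pb \<otimes> word_prod W c"
    using p scl cl by (metis m_assoc m_closed word_prod_closed)
  then have "word_prod W (a @ b @ c) = word_prod W u"
    using cl cl' p scl by (simp add: u_eq word_prod_append pa_def[symmetric] pb_def[symmetric])
  moreover have "subseq (b @ c) (s # b @ t # c)"
    by (rule list_emb_Cons, rule list_emb_append_mono) auto
  then have "subseq (a @ b @ c) u"
    by (simp only: u_eq subseq_append')
  moreover have "length (a @ b @ c) < length u"
    by (simp add: u_eq)
  ultimately show thesis
    using that by blast
qed

text \<open>
  If all reflections of u were distinct, each would occur an odd number of times, hence also in any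
  word with the same product, which could then not be shorter than u.
\<close>

lemma deletion:
  assumes "set u \<subseteq> S" "set v \<subseteq> S" "word_prod W u = word_prod W v" "length v < length u"
  obtains u' where "subseq u' u" "length u' < length u" "word_prod W u' = word_prod W u"
proof -
  have par: "even (count_list (reflections u) r) = even (count_list (reflections v) r)" for r
    using assms by (intro reflection_parity_invariant presentation)
  have "\<not> distinct (reflections u)"
  proof
    assume d: "distinct (reflections u)"
    have "set (reflections u) \<subseteq> set (reflections v)"
    proof
      fix r assume "r \<in> set (reflections u)"
      moreover have "distinct xs \<Longrightarrow> r \<in> set xs \<Longrightarrow> count_list xs r = 1" for xs
        by (induction xs) (auto simp: count_list_0_iff)
      ultimately have "count_list (reflections u) r = 1"
        using d by blast
      then have "count_list (reflections v) r \<noteq> 0"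
        using par[of r] by (metis dvd_0_right odd_one)
      then show "r \<in> set (reflections v)"
        by (simp add: count_list_0_iff)
    qed
    then have "card (set (reflections u)) \<le> card (set (reflections v))"
      by (intro card_mono) auto
    then have "length u \<le> length v"
      using distinct_card[OF d] card_length[of "reflections v"] by simp
    then show False
      using assms by simp
  qed
  then show thesis
    using delete_equal_reflections[OF assms(1)] that by blast
qed

section \<open>Minimal coset representatives\<close>

lemma generate_words:
  assumes J: "J \<subseteq> S"
  shows "w \<in> generate W J \<Longrightarrow> \<exists>ws. set ws \<subseteq> J \<and> word_prod W ws = w"
proof (induction rule: generate.induct)
  case one
  then show ?case by (intro exI[of _ "[]"]) simp
next
  case (incl h)
  then show ?case using J S_carrier by (intro exI[of _ "[h]"]) auto
next
  case (inv h)
  then show ?case using J S_carrier S_inv by (intro exI[of _ "[h]"]) auto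
next
  case (eng g h)
  then obtain us vs where "set us \<subseteq> J" "word_prod W us = g" "set vs \<subseteq> J" "word_prod W vs = h"
    by blast
  then show ?case using J gens_closed
    by (intro exI[of _ "us @ vs"]) (subst word_prod_append, auto)
qed

lemma word_prod_generate: "set ws \<subseteq> J \<Longrightarrow> word_prod W ws \<in> generate W J"
  by (induction ws) (auto intro: generate.intros)

lemma reduced_word:
  assumes "w \<in> carrier W"
  obtains ws where "set ws \<subseteq> S" "word_prod W ws = w" "length ws = cox_length W S w"
proof -
  have "\<exists>k ws. set ws \<subseteq> S \<and> word_prod W ws = w \<and> length ws = k"
    using generate_words[of S] assms gens_generate by blast
  from LeastI_ex[OF this] show thesis
    using that unfolding cox_length_def by blast
qed

lemma cox_length_le: "set ws \<subseteq> S \<Longrightarrow> cox_length W S (word_prod W ws) \<le> length ws"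
  unfolding cox_length_def by (rule Least_le) blast

lemma cox_length_one: "cox_length W S \<one> = 0"
  using cox_length_le[of "[]"] by simp

text \<open>
  Join a reduced word for n to a shortest word in J for h.  If the result were not reduced, a proper
  subword would have the same product.  It cannot lose letters of n, because n is shortest in
  its coset, and it cannot lose letters of h alone, by the choice of that word.
\<close>

lemma concat_reduced_if_minimal_in_coset:
  assumes J: "J \<subseteq> S" and n: "n \<in> carrier W"
    and min: "\<And>h. h \<in> generate W J \<Longrightarrow> cox_length W S n \<le> cox_length W S (n \<otimes> h)"
    and hs: "set hs \<subseteq> J"
    and hs_min: "\<And>hs'. \<lbrakk>set hs' \<subseteq> J; word_prod W hs' = word_prod W hs\<rbrakk> \<Longrightarrow> length hs \<le> length hs'"
  shows "cox_length W S (n \<otimes> word_prod W hs) = cox_length W S n + length hs"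
proof (rule ccontr)
  assume neq: "cox_length W S (n \<otimes> word_prod W hs) \<noteq> cox_length W S n + length hs"
  obtain ns where ns: "set ns \<subseteq> S" "word_prod W ns = n" "length ns = cox_length W S n"
    using reduced_word[OF n] .
  have cl: "set ns \<subseteq> carrier W" "set hs \<subseteq> carrier W"
    using ns hs J gens_closed by auto
  have prod: "word_prod W (ns @ hs) = n \<otimes> word_prod W hs"
    using cl ns by (simp add: word_prod_append)
  have nhs: "set (ns @ hs) \<subseteq> S"
    using ns hs J by auto
  then have "cox_length W S (n \<otimes> word_prod W hs) < length (ns @ hs)"
    using cox_length_le[OF nhs] neq ns prod by simp
  moreover obtain vs where "set vs \<subseteq> S" "word_prod W vs = n \<otimes> word_prod W hs"
    "length vs = cox_length W S (n \<otimes> word_prod W hs)"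
    using reduced_word[of "n \<otimes> word_prod W hs"] n cl by auto
  ultimately obtain ws where ws: "subseq ws (ns @ hs)" "length ws < length (ns @ hs)"
    "word_prod W ws = n \<otimes> word_prod W hs"
    using deletion[OF nhs, of vs] prod by metis
  then obtain ns' hs' where split: "ws = ns' @ hs'" "subseq ns' ns" "subseq hs' hs"
    using subseq_appendE[of ws ns hs] by blast
  have sub: "set ns' \<subseteq> S" "set hs' \<subseteq> J"
    using split(2,3) ns hs by (blast dest: list_emb_set)+
  have cl': "set ns' \<subseteq> carrier W" "set hs' \<subseteq> carrier W"
    using sub J gens_closed by auto
  have sg: "subgroup (generate W J) W"
    using J gens_closed by (intro generate_is_subgroup) auto
  define h where "h = word_prod W hs"
  define h' where "h' = word_prod W hs'"
  have h: "h \<in> generate W J" "h' \<in> generate W J"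
    using hs sub word_prod_generate by (auto simp: h_def h'_def)
  have hc: "h \<in> carrier W" "h' \<in> carrier W"
    using cl cl' by (auto simp: h_def h'_def)
  have eq: "word_prod W ns' \<otimes> h' = n \<otimes> h"
    using ws(3) cl' by (simp add: split word_prod_append h_def h'_def)
  then have "word_prod W ns' = n \<otimes> (h \<otimes> inv h')"
    using hc n cl' by (metis inv_closed inv_solve_right m_assoc m_closed word_prod_closed)
  then have "cox_length W S n \<le> length ns'"
    using min[of "h \<otimes> inv h'"] h sg cox_length_le[OF sub(1)]
    by (metis order_trans subgroup.m_closed subgroup.m_inv_closed)
  then have "ns' = ns"
    using split(2) ns(3) by (metis list_emb_length order_antisym subseq_same_length)
  then have "h' = h" "length hs' < length hs"
    using eq ns hc n ws(2) split(1) by auto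
  then show False
    using hs_min[OF sub(2)] by (simp add: h_def h'_def)
qed

lemma length_additive_if_minimal_in_coset:
  assumes J: "J \<subseteq> S" and n: "n \<in> carrier W"
    and min: "\<And>h. h \<in> generate W J \<Longrightarrow> cox_length W S n \<le> cox_length W S (n \<otimes> h)"
    and h: "h \<in> generate W J"
  shows "cox_length W S (n \<otimes> h) = cox_length W S n + cox_length W S h"
proof -
  obtain hs where hs: "set hs \<subseteq> J" "word_prod W hs = h"
    and hs_min: "\<And>hs'. \<lbrakk>set hs' \<subseteq> J; word_prod W hs' = h\<rbrakk> \<Longrightarrow> length hs \<le> length hs'"
    using generate_words[OF J h]
      arg_min_natI[of "\<lambda>ws. set ws \<subseteq> J \<and> word_prod W ws = h" _ length]
      arg_min_nat_le[of "\<lambda>ws. set ws \<subseteq> J \<and> word_prod W ws = h" _ length]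
    by (metis (no_types, lifting))
  have h_car: "h \<in> carrier W"
    using hs J gens_closed by (metis order_trans word_prod_closed)
  \<comment> \<open>The case \<open>n = 1\<close> shows that the shortest word in J for h is reduced in W.\<close>
  have "cox_length W S (\<one> \<otimes> word_prod W hs) = cox_length W S \<one> + length hs"
    using hs hs_min cox_length_one by (intro concat_reduced_if_minimal_in_coset[OF J]) auto
  moreover have "cox_length W S (n \<otimes> word_prod W hs) = cox_length W S n + length hs"
    using hs hs_min by (intro concat_reduced_if_minimal_in_coset[OF J n min]) auto
  ultimately show ?thesis
    using hs h_car cox_length_one by simp
qed

lemma cox_length_eq_0: "\<lbrakk>w \<in> carrier W; cox_length W S w = 0\<rbrakk> \<Longrightarrow> w = \<one>"
  using reduced_word by (metis length_0_conv word_prod_simps(1))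

end

text \<open>
  As q runs through \<open>W\<^sub>Jx\<close>, the element \<open>wq\<^sup>-\<^sup>1\<close> runs through the left coset \<open>wx\<^sup>-\<^sup>1W\<^sub>J\<close>, so q is determined
  by the minimal representative of that coset.
\<close>

locale parabolic_coset = coxeter_system W S for W (structure) and S +
  fixes J and x
  assumes J: "J \<subseteq> S" and x: "x \<in> carrier W"
begin

abbreviation "P \<equiv> generate W J #> x"

lemma J_carrier: "J \<subseteq> carrier W"
  using J gens_closed by blast

lemma subgroup_J: "subgroup (generate W J) W"
  by (rule generate_is_subgroup[OF J_carrier])

lemma P_carrier: "q \<in> P \<Longrightarrow> q \<in> carrier W"
  using r_coset_subset_G[OF generate_incl[OF J_carrier] x] by blast

lemma P_quotient:
  assumes "q \<in> P" "q' \<in> P"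
  shows "q \<otimes> inv q' \<in> generate W J"
proof -
  obtain h h' where h: "h \<in> generate W J" "q = h \<otimes> x" "h' \<in> generate W J" "q' = h' \<otimes> x"
    using assms by (auto simp: r_coset_def)
  then have "h \<in> carrier W" "h' \<in> carrier W"
    using subgroup.mem_carrier[OF subgroup_J] by auto
  then have "q \<otimes> inv q' = h \<otimes> inv h'"
    using h x m_assoc[of x "inv x" "inv h'"] by (simp add: inv_mult_group m_assoc)
  then show ?thesis
    using h subgroup_J by (simp add: subgroup.m_closed subgroup.m_inv_closed)
qed

lemma P_translate:
  assumes "h \<in> generate W J" "q \<in> P"
  shows "h \<otimes> q \<in> P"
proof -
  obtain k where k: "k \<in> generate W J" "q = k \<otimes> x"
    using assms by (auto simp: r_coset_def)
  then have "h \<otimes> q = (h \<otimes> k) \<otimes> x" "h \<otimes> k \<in> generate W J"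
    using assms x subgroup.mem_carrier[OF subgroup_J] subgroup.m_closed[OF subgroup_J]
    by (auto simp: m_assoc)
  then show ?thesis
    by (auto simp: r_coset_def)
qed

lemma minimal_quotient:
  assumes w: "w \<in> carrier W" and q: "q \<in> P"
    and min: "\<And>r. r \<in> P \<Longrightarrow> cox_length W S (w \<otimes> inv q) \<le> cox_length W S (w \<otimes> inv r)"
    and h: "h \<in> generate W J"
  shows "cox_length W S (w \<otimes> inv q \<otimes> h) = cox_length W S (w \<otimes> inv q) + cox_length W S h"
proof (rule length_additive_if_minimal_in_coset[OF J _ _ h])
  show "w \<otimes> inv q \<in> carrier W"
    using w q P_carrier by simp
  fix k assume k: "k \<in> generate W J"
  then have kc: "k \<in> carrier W" "q \<in> carrier W"
    using subgroup.mem_carrier[OF subgroup_J] q P_carrier by auto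
  have "inv k \<otimes> q \<in> P"
    using k q subgroup.m_inv_closed[OF subgroup_J] by (intro P_translate) auto
  then show "cox_length W S (w \<otimes> inv q) \<le> cox_length W S (w \<otimes> inv q \<otimes> k)"
    using min[of "inv k \<otimes> q"] kc w by (simp add: inv_mult_group m_assoc)
qed

lemma coset_p_spec:
  assumes w: "w \<in> carrier W"
  shows "coset_p W S P w \<in> P \<and>
    (\<forall>q \<in> P. cox_length W S (w \<otimes> inv (coset_p W S P w)) \<le> cox_length W S (w \<otimes> inv q))"
  unfolding coset_p_def
proof (rule theI', rule ex_ex1I)
  let ?Q = "\<lambda>p. p \<in> P \<and> (\<forall>q \<in> P. cox_length W S (w \<otimes> inv p) \<le> cox_length W S (w \<otimes> inv q))"
  have "x \<in> P"
    using x subgroup.one_closed[OF subgroup_J] by (auto simp: r_coset_def intro!: bexI[of _ \<one>])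
  then show "\<exists>p. ?Q p"
    using ex_has_least_nat[of "\<lambda>q. q \<in> P" x "\<lambda>q. cox_length W S (w \<otimes> inv q)"] by blast
  fix p q assume p: "?Q p" and q: "?Q q"
  then have c: "p \<in> carrier W" "q \<in> carrier W"
    using P_carrier by auto
  have "cox_length W S (w \<otimes> inv p \<otimes> (p \<otimes> inv q))
      = cox_length W S (w \<otimes> inv p) + cox_length W S (p \<otimes> inv q)"
    using p q by (intro minimal_quotient[OF w] P_quotient) auto
  moreover have "w \<otimes> inv p \<otimes> (p \<otimes> inv q) = w \<otimes> inv q"
    using c w m_assoc[of "inv p" p "inv q"] by (simp add: m_assoc)
  moreover have "cox_length W S (w \<otimes> inv p) = cox_length W S (w \<otimes> inv q)"
    using p q by (meson order_antisym)
  ultimately have "p \<otimes> inv q = \<one>"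
    using c by (intro cox_length_eq_0) auto
  then show "p = q"
    using c by (metis inv_closed inv_equality inv_inv)
qed

lemma coset_p_in: "w \<in> carrier W \<Longrightarrow> coset_p W S P w \<in> P"
  using coset_p_spec by blast

lemma coset_p_id:
  assumes "w \<in> P"
  shows "coset_p W S P w = w"
proof -
  have w: "w \<in> carrier W"
    using assms P_carrier by blast
  have p: "coset_p W S P w \<in> carrier W"
    using coset_p_in[OF w] P_carrier by blast
  have "cox_length W S (w \<otimes> inv (coset_p W S P w)) \<le> cox_length W S (w \<otimes> inv w)"
    using coset_p_spec[OF w] assms by blast
  then have "cox_length W S (w \<otimes> inv (coset_p W S P w)) = 0"
    using w by (simp add: cox_length_one)
  then have "w \<otimes> inv (coset_p W S P w) = \<one>"
    using w p by (intro cox_length_eq_0) auto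
  then show ?thesis
    using w p by (metis inv_closed inv_equality inv_inv)
qed

lemma length_coset_n:
  assumes "w \<in> carrier W" "h \<in> generate W J"
  shows "cox_length W S (coset_n W S P w \<otimes> h)
    = cox_length W S (coset_n W S P w) + cox_length W S h"
  using coset_p_spec[OF assms(1)] assms unfolding coset_n_def by (intro minimal_quotient) auto

end

section \<open>Calculations in a category\<close>

lemma HomD: "f \<in> Hom C X Y \<Longrightarrow> f \<in> Arr C \<and> Dom C f = X \<and> Cod C f = Y"
  by (simp add: Hom_def)

context category
begin

lemma cmp_arr:
  assumes "f \<in> Arr C" "g \<in> Arr C" "Dom C g = Cod C f"
  shows "g \<cdot> f \<in> Arr C" "Dom C (g \<cdot> f) = Dom C f" "Cod C (g \<cdot> f) = Cod C g"
  using cmp_closed[of f "Dom C f" "Cod C f" g "Cod C g"] assms by (auto simp: Hom_def)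

lemma cmp_assoc_arr:
  "\<lbrakk>f \<in> Arr C; g \<in> Arr C; h \<in> Arr C; Dom C g = Cod C f; Dom C h = Cod C g\<rbrakk>
    \<Longrightarrow> (h \<cdot> g) \<cdot> f = h \<cdot> (g \<cdot> f)"
  using cmp_assoc[of f "Dom C f" "Cod C f" g "Cod C g" h "Cod C h"] by (auto simp: Hom_def)

lemmas arr_simps = cmp_arr cmp_assoc_arr

lemma cmp_idn_left': "\<lbrakk>f \<in> Arr C; Cod C f = Y\<rbrakk> \<Longrightarrow> Idn C Y \<cdot> f = f"
  using cmp_idn_left[of f "Dom C f" Y] by (auto simp: Hom_def)

lemma cmp_idn_right': "\<lbrakk>f \<in> Arr C; Dom C f = X\<rbrakk> \<Longrightarrow> f \<cdot> Idn C X = f"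
  using cmp_idn_right[of f X "Cod C f"] by (auto simp: Hom_def)

text \<open>
  Compositions are normalized by bracketing them to the right.  An equation between two binary
  compositions then matches only at the end of a longer one; the next two lemmas extend it to the
  inside.
\<close>

lemma square_extend:
  assumes "f \<cdot> g = h \<cdot> k" "f \<in> Arr C" "g \<in> Arr C" "h \<in> Arr C" "k \<in> Arr C"
    "Dom C f = Cod C g" "Dom C h = Cod C k" "e \<in> Arr C" "Cod C e = Dom C g"
  shows "f \<cdot> (g \<cdot> e) = h \<cdot> (k \<cdot> e)"
proof -
  have "Dom C k = Dom C g"
    using assms(1) cmp_arr(2)[of g f] cmp_arr(2)[of k h] assms by simp
  then show ?thesis
    using assms by (simp add: cmp_assoc_arr[symmetric])
qed

lemma retract_extend:
  assumes "f \<cdot> g = Idn C X" "f \<in> Arr C" "g \<in> Arr C" "Dom C f = Cod C g"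
    "e \<in> Arr C" "Cod C e = Dom C g" "X = Dom C g"
  shows "f \<cdot> (g \<cdot> e) = e"
  using assms by (simp add: cmp_assoc_arr[symmetric] cmp_idn_left')

lemma inverse_unique:
  assumes "is_inverse C f g" "is_inverse C f h"
  shows "g = h"
proof -
  have f: "f \<in> Arr C" and g: "g \<in> Arr C" "Dom C g = Cod C f" "Cod C g = Dom C f"
    and h: "h \<in> Arr C" "Dom C h = Cod C f" "Cod C h = Dom C f"
    and e: "g \<cdot> f = Idn C (Dom C f)" "f \<cdot> h = Idn C (Cod C f)"
    using assms by (auto simp: is_inverse_def Hom_def)
  have "g = g \<cdot> (f \<cdot> h)"
    using g by (simp add: e cmp_idn_right')
  also have "\<dots> = h"
    using f g h by (simp add: cmp_assoc_arr[symmetric] e(1) cmp_idn_left')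
  finally show ?thesis .
qed

lemma inverse_arr_eq: "is_inverse C f g \<Longrightarrow> inverse_arr C f = g"
  unfolding inverse_arr_def using inverse_unique by blast

lemma inverse_arr_inverse: "is_iso C f \<Longrightarrow> is_inverse C f (inverse_arr C f)"
  using inverse_arr_eq by (auto simp: is_iso_def)

lemma inverse_arr_hom:
  assumes "is_iso C f" "f \<in> Hom C X Y"
  shows "inverse_arr C f \<in> Hom C Y X" "inverse_arr C f \<cdot> f = Idn C X" "f \<cdot> inverse_arr C f = Idn C Y"
  using inverse_arr_inverse[OF assms(1)] assms(2) by (auto simp: is_inverse_def Hom_def)

lemma inverse_arr_idn: "X \<in> Obj C \<Longrightarrow> inverse_arr C (Idn C X) = Idn C X"
  using idn_closed[of X] cmp_idn_left[of "Idn C X" X X]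
  by (intro inverse_arr_eq) (auto simp: is_inverse_def Hom_def)

lemma square_invert:
  assumes "i \<cdot> f = g \<cdot> j" "is_iso C i" "is_iso C j"
    and "j \<in> Hom C X X'" "i \<in> Hom C Y Y'" "f \<in> Hom C X Y" "g \<in> Hom C X' Y'"
  shows "inverse_arr C i \<cdot> g = f \<cdot> inverse_arr C j"
proof -
  note H = assms(4-7) inverse_arr_hom(1)[OF assms(2,5)] inverse_arr_hom(1)[OF assms(3,4)]
  note [simp] = H[THEN HomD, THEN conjunct1] H[THEN HomD, THEN conjunct2, THEN conjunct1]
    H[THEN HomD, THEN conjunct2, THEN conjunct2]
  have "inverse_arr C i \<cdot> g = inverse_arr C i \<cdot> (g \<cdot> (j \<cdot> inverse_arr C j))"
    by (simp add: inverse_arr_hom(3)[OF assms(3,4)] cmp_idn_right')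
  also have "\<dots> = inverse_arr C i \<cdot> (i \<cdot> (f \<cdot> inverse_arr C j))"
    by (subst square_extend[OF assms(1)]) simp_all
  also have "\<dots> = f \<cdot> inverse_arr C j"
    by (rule retract_extend[OF inverse_arr_hom(2)[OF assms(2,5)]]) (simp_all add: cmp_arr)
  finally show ?thesis .
qed

end

section \<open>Categories of glued objects\<close>

context gluing_data
begin

lemma category_C: "w \<in> carrier W \<Longrightarrow> category (C w)"
  using Phi_right_exact[of \<one> w] by (simp add: right_exact_functor_def is_functor_def)

lemma Phi_functor: "\<lbrakk>w \<in> carrier W; v \<in> carrier W\<rbrakk> \<Longrightarrow> is_functor (C v) (C (w \<otimes> v)) (\<Phi> w v)"
  using Phi_right_exact by (simp add: right_exact_functor_def)

text \<open>
  In the following forms of the axioms the indices of the categories are independent variables, so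
  that they apply to every factorization of a group element.
\<close>

lemma Phi_obj:
  "\<lbrakk>w \<in> carrier W; v \<in> carrier W; u = w \<otimes> v; A \<in> Obj (C v)\<rbrakk> \<Longrightarrow> FObj (\<Phi> w v) A \<in> Obj (C u)"
  using is_functor.obj_closed[OF Phi_functor] by blast

lemma Phi_hom:
  "\<lbrakk>w \<in> carrier W; v \<in> carrier W; u = w \<otimes> v; f \<in> Hom (C v) A B\<rbrakk>
    \<Longrightarrow> FArr (\<Phi> w v) f \<in> Hom (C u) (FObj (\<Phi> w v) A) (FObj (\<Phi> w v) B)"
  using is_functor.arr_closed[OF Phi_functor] by blast

lemma Phi_idn:
  "\<lbrakk>w \<in> carrier W; v \<in> carrier W; u = w \<otimes> v; A \<in> Obj (C v)\<rbrakk>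
    \<Longrightarrow> FArr (\<Phi> w v) (Idn (C v) A) = Idn (C u) (FObj (\<Phi> w v) A)"
  using is_functor.map_idn[OF Phi_functor] by blast

lemma Phi_cmp:
  "\<lbrakk>w \<in> carrier W; v \<in> carrier W; u = w \<otimes> v; f \<in> Hom (C v) X Y; g \<in> Hom (C v) Y Z\<rbrakk>
    \<Longrightarrow> FArr (\<Phi> w v) (g \<cdot>\<^bsub>C v\<^esub> f) = FArr (\<Phi> w v) g \<cdot>\<^bsub>C u\<^esub> FArr (\<Phi> w v) f"
  using is_functor.map_cmp[OF Phi_functor] by blast

lemma nu_hom:
  "\<lbrakk>w \<in> carrier W; w' \<in> carrier W; a \<in> carrier W; v = w' \<otimes> a; z = w \<otimes> w'; u = w \<otimes> v;
     A \<in> Obj (C a)\<rbrakk>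
    \<Longrightarrow> \<nu> w w' a A \<in> Hom (C u) (FObj (\<Phi> w v) (FObj (\<Phi> w' a) A)) (FObj (\<Phi> z a) A)"
  using nu_closed[of w w' a A] by (simp add: m_assoc)

lemma nu_nat:
  "\<lbrakk>w \<in> carrier W; w' \<in> carrier W; a \<in> carrier W; v = w' \<otimes> a; z = w \<otimes> w'; u = w \<otimes> v;
     f \<in> Hom (C a) A B\<rbrakk>
    \<Longrightarrow> \<nu> w w' a B \<cdot>\<^bsub>C u\<^esub> FArr (\<Phi> w v) (FArr (\<Phi> w' a) f) = FArr (\<Phi> z a) f \<cdot>\<^bsub>C u\<^esub> \<nu> w w' a A"
  using nu_natural[of w w' a f A B] by (simp add: m_assoc)

lemma nu_cocycle:
  "\<lbrakk>w \<in> carrier W; w' \<in> carrier W; w'' \<in> carrier W; a \<in> carrier W;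
     b = w'' \<otimes> a; c = w' \<otimes> b; u = w \<otimes> c; y = w \<otimes> w'; z = w' \<otimes> w''; A \<in> Obj (C a)\<rbrakk>
    \<Longrightarrow> \<nu> y w'' a A \<cdot>\<^bsub>C u\<^esub> \<nu> w w' b (FObj (\<Phi> w'' a) A)
      = \<nu> w z a A \<cdot>\<^bsub>C u\<^esub> FArr (\<Phi> w c) (\<nu> w' w'' a A)"
  using nu_assoc[of w w' w'' a A] by (simp add: m_assoc)

lemma glue_obj_component: "\<lbrakk>(A, \<alpha>) \<in> glue_objects W C \<Phi> \<nu> Q; w \<in> Q\<rbrakk> \<Longrightarrow> A w \<in> Obj (C w)"
  by (simp add: glue_objects_def)

lemma glue_obj_hom:
  "\<lbrakk>(A, \<alpha>) \<in> glue_objects W C \<Phi> \<nu> Q; w \<in> carrier W; v \<in> Q; u = w \<otimes> v; u \<in> Q\<rbrakk>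
    \<Longrightarrow> \<alpha> (w, v) \<in> Hom (C u) (FObj (\<Phi> w v) (A v)) (A u)"
  by (auto simp: glue_objects_def glue_index_def)

lemma glue_obj_one: "\<lbrakk>(A, \<alpha>) \<in> glue_objects W C \<Phi> \<nu> Q; w \<in> Q\<rbrakk> \<Longrightarrow> \<alpha> (\<one>, w) = Idn (C w) (A w)"
  by (auto simp: glue_objects_def)

lemma glue_obj_assoc:
  assumes "(A, \<alpha>) \<in> glue_objects W C \<Phi> \<nu> Q" "Q \<subseteq> carrier W" "w \<in> carrier W" "w' \<in> carrier W"
    "a \<in> Q" "v = w' \<otimes> a" "v \<in> Q" "z = w \<otimes> w'" "u = w \<otimes> v" "u \<in> Q"
  shows "\<alpha> (w, v) \<cdot>\<^bsub>C u\<^esub> FArr (\<Phi> w v) (\<alpha> (w', a)) = \<alpha> (z, a) \<cdot>\<^bsub>C u\<^esub> \<nu> w w' a (A a)"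
proof -
  have u: "w \<otimes> w' \<otimes> a = u"
    using assms by (auto simp: m_assoc)
  have "w \<otimes> w' \<otimes> a \<in> Q \<Longrightarrow> \<alpha> (w, w' \<otimes> a) \<cdot>\<^bsub>C (w \<otimes> w' \<otimes> a)\<^esub> FArr (\<Phi> w (w' \<otimes> a)) (\<alpha> (w', a))
      = \<alpha> (w \<otimes> w', a) \<cdot>\<^bsub>C (w \<otimes> w' \<otimes> a)\<^esub> \<nu> w w' a (A a)"
    using assms(1,3,4,5,7) unfolding assms(6) by (simp add: glue_objects_def)
  then show ?thesis
    unfolding u using assms(6,8,10) by simp
qed

lemma glue_objectsI:
  assumes "Q \<subseteq> carrier W" "A \<in> extensional Q" "\<alpha> \<in> extensional (glue_index W Q)"
    and "\<And>w. w \<in> Q \<Longrightarrow> A w \<in> Obj (C w)"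
    and "\<And>w v u. \<lbrakk>w \<in> carrier W; v \<in> Q; u = w \<otimes> v; u \<in> Q\<rbrakk>
      \<Longrightarrow> \<alpha> (w, v) \<in> Hom (C u) (FObj (\<Phi> w v) (A v)) (A u)"
    and "\<And>w. w \<in> Q \<Longrightarrow> \<alpha> (\<one>, w) = Idn (C w) (A w)"
    and "\<And>w w' a v z u. \<lbrakk>w \<in> carrier W; w' \<in> carrier W; a \<in> Q; v = w' \<otimes> a; v \<in> Q; z = w \<otimes> w';
        u = w \<otimes> v; u \<in> Q\<rbrakk>
      \<Longrightarrow> \<alpha> (w, v) \<cdot>\<^bsub>C u\<^esub> FArr (\<Phi> w v) (\<alpha> (w', a)) = \<alpha> (z, a) \<cdot>\<^bsub>C u\<^esub> \<nu> w w' a (A a)"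
  shows "(A, \<alpha>) \<in> glue_objects W C \<Phi> \<nu> Q"
proof -
  have "\<alpha> (w, w' \<otimes> a) \<cdot>\<^bsub>C (w \<otimes> w' \<otimes> a)\<^esub> FArr (\<Phi> w (w' \<otimes> a)) (\<alpha> (w', a))
      = \<alpha> (w \<otimes> w', a) \<cdot>\<^bsub>C (w \<otimes> w' \<otimes> a)\<^esub> \<nu> w w' a (A a)"
    if "w \<in> carrier W" "w' \<in> carrier W" "a \<in> Q" "w' \<otimes> a \<in> Q" "w \<otimes> w' \<otimes> a \<in> Q" for w w' a
    using that assms(1) by (intro assms(7)) (auto simp: m_assoc)
  then show ?thesis
    using assms(2-6) by (auto simp: glue_objects_def glue_index_def)
qed

lemma glue_arr_hom: "\<lbrakk>((A, \<alpha>), (B, \<beta>), f) \<in> glue_arrows W C \<Phi> \<nu> Q; w \<in> Q\<rbrakk> \<Longrightarrow> f w \<in> Hom (C w) (A w) (B w)"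
  by (simp add: glue_arrows_def)

lemma glue_arr_square:
  "\<lbrakk>((A, \<alpha>), (B, \<beta>), f) \<in> glue_arrows W C \<Phi> \<nu> Q; w \<in> carrier W; v \<in> Q; u = w \<otimes> v; u \<in> Q\<rbrakk>
    \<Longrightarrow> f u \<cdot>\<^bsub>C u\<^esub> \<alpha> (w, v) = \<beta> (w, v) \<cdot>\<^bsub>C u\<^esub> FArr (\<Phi> w v) (f v)"
  by (auto simp: glue_arrows_def glue_index_def)

lemma glue_cat_simps [simp]:
  "Obj (glue_cat W C \<Phi> \<nu> Q) = glue_objects W C \<Phi> \<nu> Q"
  "Arr (glue_cat W C \<Phi> \<nu> Q) = glue_arrows W C \<Phi> \<nu> Q"
  "Dom (glue_cat W C \<Phi> \<nu> Q) (X, Y, f) = X"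
  "Cod (glue_cat W C \<Phi> \<nu> Q) (X, Y, f) = Y"
  "Idn (glue_cat W C \<Phi> \<nu> Q) X = (X, X, \<lambda>w\<in>Q. Idn (C w) (fst X w))"
  "(Y, Z, g) \<cdot>\<^bsub>glue_cat W C \<Phi> \<nu> Q\<^esub> (X, Y', f) = (X, Z, \<lambda>w\<in>Q. g w \<cdot>\<^bsub>C w\<^esub> f w)"
  by (simp_all add: glue_cat_def)

lemma glue_hom_iff:
  "m \<in> Hom (glue_cat W C \<Phi> \<nu> Q) X Y \<longleftrightarrow> (\<exists>f. m = (X, Y, f) \<and> (X, Y, f) \<in> glue_arrows W C \<Phi> \<nu> Q)"
  by (cases m) (auto simp: Hom_def)

lemma glue_idn_arrow:
  assumes Q: "Q \<subseteq> carrier W" and X: "(A, \<alpha>) \<in> glue_objects W C \<Phi> \<nu> Q"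
  shows "((A, \<alpha>), (A, \<alpha>), \<lambda>w\<in>Q. Idn (C w) (A w)) \<in> glue_arrows W C \<Phi> \<nu> Q"
proof -
  have "Idn (C (w \<otimes> v)) (A (w \<otimes> v)) \<cdot>\<^bsub>C (w \<otimes> v)\<^esub> \<alpha> (w, v)
      = \<alpha> (w, v) \<cdot>\<^bsub>C (w \<otimes> v)\<^esub> FArr (\<Phi> w v) (Idn (C v) (A v))"
    if "w \<in> carrier W" "v \<in> Q" "w \<otimes> v \<in> Q" for w v
  proof -
    have c: "v \<in> carrier W" "w \<otimes> v \<in> carrier W" using that Q by auto
    have h: "\<alpha> (w, v) \<in> Hom (C (w \<otimes> v)) (FObj (\<Phi> w v) (A v)) (A (w \<otimes> v))"
      using glue_obj_hom[OF X] that by simp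
    show ?thesis
      using category.cmp_idn_left[OF category_C h] category.cmp_idn_right[OF category_C h] c
        Phi_idn[OF that(1) c(1) HOL.refl glue_obj_component[OF X that(2)]] by simp
  qed
  moreover have "Idn (C w) (A w) \<in> Hom (C w) (A w) (A w)" if "w \<in> Q" for w
    using category.idn_closed[OF category_C glue_obj_component[OF X that]] that Q by auto
  ultimately show ?thesis
    using X by (auto simp: glue_arrows_def glue_index_def)
qed

lemma glue_cmp_arrow:
  assumes Q: "Q \<subseteq> carrier W" and f: "((A, \<alpha>), (B, \<beta>), f) \<in> glue_arrows W C \<Phi> \<nu> Q"
    and g: "((B, \<beta>), (D, \<delta>), g) \<in> glue_arrows W C \<Phi> \<nu> Q"
  shows "((A, \<alpha>), (D, \<delta>), \<lambda>w\<in>Q. g w \<cdot>\<^bsub>C w\<^esub> f w) \<in> glue_arrows W C \<Phi> \<nu> Q"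
proof -
  have X: "(A, \<alpha>) \<in> glue_objects W C \<Phi> \<nu> Q" and Y: "(B, \<beta>) \<in> glue_objects W C \<Phi> \<nu> Q"
    and Z: "(D, \<delta>) \<in> glue_objects W C \<Phi> \<nu> Q"
    using f g by (auto simp: glue_arrows_def)
  have "(g u \<cdot>\<^bsub>C u\<^esub> f u) \<cdot>\<^bsub>C u\<^esub> \<alpha> (w, v) = \<delta> (w, v) \<cdot>\<^bsub>C u\<^esub> FArr (\<Phi> w v) (g v \<cdot>\<^bsub>C v\<^esub> f v)"
    if w: "w \<in> carrier W" "v \<in> Q" "u \<in> Q" "u = w \<otimes> v" for w v u
  proof -
    have c: "v \<in> carrier W" "u \<in> carrier W" using w Q by auto
    interpret category "C u" by (rule category_C[OF c(2)])
    note H = glue_arr_hom[OF f w(3)] glue_arr_hom[OF g w(3)] glue_obj_hom[OF X w(1,2,4,3)]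
      glue_obj_hom[OF Y w(1,2,4,3)] glue_obj_hom[OF Z w(1,2,4,3)]
      Phi_hom[OF w(1) c(1) w(4) glue_arr_hom[OF f w(2)]]
      Phi_hom[OF w(1) c(1) w(4) glue_arr_hom[OF g w(2)]]
    note [simp] = H[THEN HomD, THEN conjunct1] H[THEN HomD, THEN conjunct2, THEN conjunct1]
      H[THEN HomD, THEN conjunct2, THEN conjunct2]
    note sq = glue_arr_square[OF f w(1,2,4,3)] glue_arr_square[OF g w(1,2,4,3)]
    show ?thesis
      using Phi_cmp[OF w(1) c(1) w(4) glue_arr_hom[OF f w(2)] glue_arr_hom[OF g w(2)]]
      by (simp add: arr_simps sq square_extend[OF sq(2)])
  qed
  moreover have "g w \<cdot>\<^bsub>C w\<^esub> f w \<in> Hom (C w) (A w) (D w)" if "w \<in> Q" for w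
    using category.cmp_closed[OF category_C glue_arr_hom[OF f that] glue_arr_hom[OF g that]] that Q by auto
  ultimately show ?thesis
    using X Z by (auto simp: glue_arrows_def glue_index_def)
qed

text \<open>All category laws hold componentwise.\<close>

lemma glue_category:
  assumes Q: "Q \<subseteq> carrier W"
  shows "category (glue_cat W C \<Phi> \<nu> Q)"
proof
  let ?G = "glue_cat W C \<Phi> \<nu> Q"
  fix f assume "f \<in> Arr ?G"
  then show "Dom ?G f \<in> Obj ?G" "Cod ?G f \<in> Obj ?G"
    by (auto simp: glue_arrows_def)
next
  let ?G = "glue_cat W C \<Phi> \<nu> Q"
  fix X assume "X \<in> Obj ?G"
  then show "Idn ?G X \<in> Hom ?G X X"
    using glue_idn_arrow[OF Q] by (cases X) (auto simp: glue_hom_iff)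
next
  let ?G = "glue_cat W C \<Phi> \<nu> Q"
  fix f g X Y Z assume "f \<in> Hom ?G X Y" "g \<in> Hom ?G Y Z"
  then show "g \<cdot>\<^bsub>?G\<^esub> f \<in> Hom ?G X Z"
    using glue_cmp_arrow[OF Q]
    by (cases X, cases Y, cases Z) (auto simp: glue_hom_iff)
next
  let ?G = "glue_cat W C \<Phi> \<nu> Q"
  fix f g h X Y Z V assume "f \<in> Hom ?G X Y" "g \<in> Hom ?G Y Z" "h \<in> Hom ?G Z V"
  then obtain f' g' h' where a: "f = (X, Y, f')" "(X, Y, f') \<in> glue_arrows W C \<Phi> \<nu> Q"
    "g = (Y, Z, g')" "(Y, Z, g') \<in> glue_arrows W C \<Phi> \<nu> Q"
    "h = (Z, V, h')" "(Z, V, h') \<in> glue_arrows W C \<Phi> \<nu> Q"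
    by (auto simp: glue_hom_iff)
  have "(h' w \<cdot>\<^bsub>C w\<^esub> g' w) \<cdot>\<^bsub>C w\<^esub> f' w = h' w \<cdot>\<^bsub>C w\<^esub> (g' w \<cdot>\<^bsub>C w\<^esub> f' w)" if "w \<in> Q" for w
  proof (rule category.cmp_assoc[OF category_C])
    show "w \<in> carrier W" using that Q by auto
    show "f' w \<in> Hom (C w) (fst X w) (fst Y w)" "g' w \<in> Hom (C w) (fst Y w) (fst Z w)"
      "h' w \<in> Hom (C w) (fst Z w) (fst V w)"
      using a that by (auto simp: glue_arrows_def)
  qed
  then show "(h \<cdot>\<^bsub>?G\<^esub> g) \<cdot>\<^bsub>?G\<^esub> f = h \<cdot>\<^bsub>?G\<^esub> (g \<cdot>\<^bsub>?G\<^esub> f)"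
    unfolding a by (auto intro!: restrict_ext)
next
  let ?G = "glue_cat W C \<Phi> \<nu> Q"
  fix f X Y assume "f \<in> Hom ?G X Y"
  then obtain f' where f: "f = (X, Y, f')" "(X, Y, f') \<in> glue_arrows W C \<Phi> \<nu> Q"
    by (auto simp: glue_hom_iff)
  then have ext: "f' \<in> extensional Q"
    and hom: "\<And>w. w \<in> Q \<Longrightarrow> f' w \<in> Hom (C w) (fst X w) (fst Y w)"
    by (auto simp: glue_arrows_def)
  have "Idn (C w) (fst Y w) \<cdot>\<^bsub>C w\<^esub> f' w = f' w" "f' w \<cdot>\<^bsub>C w\<^esub> Idn (C w) (fst X w) = f' w"
    if "w \<in> Q" for w
    using category.cmp_idn_left[OF category_C hom[OF that]]
      category.cmp_idn_right[OF category_C hom[OF that]] that Q by auto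
  then show "Idn ?G Y \<cdot>\<^bsub>?G\<^esub> f = f" "f \<cdot>\<^bsub>?G\<^esub> Idn ?G X = f"
    using ext unfolding f by (auto intro!: extensionalityI[where A = Q])
qed

section \<open>The restriction functor\<close>

lemma j_res_obj_closed:
  assumes "Q \<subseteq> carrier W" and X: "(A, \<alpha>) \<in> glue_objects W C \<Phi> \<nu> (carrier W)"
  shows "j_res_obj W Q (A, \<alpha>) \<in> glue_objects W C \<Phi> \<nu> Q"
proof -
  note Q = subsetD[OF assms(1)]
  show ?thesis
    unfolding j_res_obj_def fst_conv snd_conv
    by (rule glue_objectsI[OF assms(1)])
      (auto simp: glue_index_def Q m_assoc glue_obj_one[OF X] intro: glue_obj_component[OF X]
        glue_obj_hom[OF X] glue_obj_assoc[OF X])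
qed

lemma j_res_arrow:
  assumes "Q \<subseteq> carrier W" "((A, \<alpha>), (B, \<beta>), f) \<in> glue_arrows W C \<Phi> \<nu> (carrier W)"
  shows "(j_res_obj W Q (A, \<alpha>), j_res_obj W Q (B, \<beta>), restrict f Q) \<in> glue_arrows W C \<Phi> \<nu> Q"
proof -
  have "j_res_obj W Q (A, \<alpha>) \<in> glue_objects W C \<Phi> \<nu> Q" "j_res_obj W Q (B, \<beta>) \<in> glue_objects W C \<Phi> \<nu> Q"
    using assms j_res_obj_closed by (auto simp: glue_arrows_def)
  then show ?thesis
    using assms by (auto simp: j_res_obj_def glue_arrows_def glue_index_def subset_iff)
qed

lemma j_res_functor:
  assumes Q: "Q \<subseteq> carrier W"
  shows "is_functor (glue_cat W C \<Phi> \<nu> (carrier W)) (glue_cat W C \<Phi> \<nu> Q) (j_res W Q)"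
proof -
  interpret G: category "glue_cat W C \<Phi> \<nu> (carrier W)" by (rule glue_category) simp
  interpret H: category "glue_cat W C \<Phi> \<nu> Q" by (rule glue_category[OF Q])
  show ?thesis
  proof
    fix X assume "X \<in> Obj (glue_cat W C \<Phi> \<nu> (carrier W))"
    then show "FObj (j_res W Q) X \<in> Obj (glue_cat W C \<Phi> \<nu> Q)"
      using j_res_obj_closed[OF Q] by (cases X) (simp add: j_res_def)
  next
    fix f X Y assume "f \<in> Hom (glue_cat W C \<Phi> \<nu> (carrier W)) X Y"
    then show "FArr (j_res W Q) f \<in> Hom (glue_cat W C \<Phi> \<nu> Q) (FObj (j_res W Q) X) (FObj (j_res W Q) Y)"
      using j_res_arrow[OF Q] by (cases X, cases Y) (auto simp: glue_hom_iff j_res_def)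
  next
    fix X assume "X \<in> Obj (glue_cat W C \<Phi> \<nu> (carrier W))"
    then show "FArr (j_res W Q) (Idn (glue_cat W C \<Phi> \<nu> (carrier W)) X)
        = Idn (glue_cat W C \<Phi> \<nu> Q) (FObj (j_res W Q) X)"
      using Q by (auto simp: j_res_def j_res_obj_def intro!: extensionalityI[where A = Q])
  next
    fix f g X Y Z
    assume "f \<in> Hom (glue_cat W C \<Phi> \<nu> (carrier W)) X Y" "g \<in> Hom (glue_cat W C \<Phi> \<nu> (carrier W)) Y Z"
    then show "FArr (j_res W Q) (g \<cdot>\<^bsub>glue_cat W C \<Phi> \<nu> (carrier W)\<^esub> f)
        = FArr (j_res W Q) g \<cdot>\<^bsub>glue_cat W C \<Phi> \<nu> Q\<^esub> FArr (j_res W Q) f"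
      using Int_absorb1[OF Q] by (auto simp: glue_hom_iff j_res_def intro!: restrict_ext)
  qed
qed

end

section \<open>The extension functor\<close>

text \<open>
  All that the adjunction needs to know about the coset \<open>P = W\<^sub>Jx\<close>: the map p is a retraction of W onto
  P, and \<open>\<nu>\<close> is invertible for the products \<open>n(u) w\<^sub>1\<close> with \<open>w\<^sub>1 = p(u) v\<^sup>-\<^sup>1\<close>, which makes the extended
  structure morphisms meaningful.  These two facts condense the
  combinatorics of minimal coset representatives.
\<close>

locale coset_extension = gluing_data W S C \<Phi> \<nu>
  for W :: "('w, 'r) monoid_scheme" (structure) and S
    and C :: "'w \<Rightarrow> ('o, 'a) cat_data" and \<Phi> and \<nu> +
  fixes P
  assumes P_sub: "P \<subseteq> carrier W"
    and p_in: "w \<in> carrier W \<Longrightarrow> coset_p W S P w \<in> P"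
    and p_id: "w \<in> P \<Longrightarrow> coset_p W S P w = w"
    and nu_n_iso: "\<lbrakk>u \<in> carrier W; v \<in> P; A \<in> Obj (C v)\<rbrakk>
      \<Longrightarrow> is_iso (C u) (\<nu> (coset_n W S P u) (coset_p W S P u \<otimes> inv v) v A)"
begin

abbreviation "p \<equiv> coset_p W S P"
abbreviation "n \<equiv> coset_n W S P"
abbreviation "glueP \<equiv> glue_cat W C \<Phi> \<nu> P"
abbreviation "glueW \<equiv> glue_cat W C \<Phi> \<nu> (carrier W)"

lemma P_in_carrier [simp]: "w \<in> P \<Longrightarrow> w \<in> carrier W"
  using P_sub by blast

lemma p_carrier [simp]: "w \<in> carrier W \<Longrightarrow> p w \<in> carrier W"
  using p_in by simp

lemma n_carrier [simp]: "w \<in> carrier W \<Longrightarrow> n w \<in> carrier W"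
  by (simp add: coset_n_def)

lemma n_p: "w \<in> carrier W \<Longrightarrow> n w \<otimes> p w = w"
  by (simp add: coset_n_def m_assoc)

lemma n_one: "w \<in> P \<Longrightarrow> n w = \<one>"
  by (simp add: coset_n_def p_id)

text \<open>This is the element \<open>w\<^sub>1\<close> in the formula for the extended structure morphisms, where \<open>u = w v\<close>.\<close>

definition p_quot :: "'w \<Rightarrow> 'w \<Rightarrow> 'w" where
  "p_quot u v = p u \<otimes> inv (p v)"

lemma p_quot_carrier [simp]: "\<lbrakk>u \<in> carrier W; v \<in> carrier W\<rbrakk> \<Longrightarrow> p_quot u v \<in> carrier W"
  by (simp add: p_quot_def)

lemma p_quot_p: "\<lbrakk>u \<in> carrier W; v \<in> carrier W\<rbrakk> \<Longrightarrow> p_quot u v \<otimes> p v = p u"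
  by (simp add: p_quot_def m_assoc)

lemma p_quot_mult:
  assumes "u \<in> carrier W" "t \<in> carrier W" "v \<in> carrier W"
  shows "p_quot u t \<otimes> p_quot t v = p_quot u v"
  using assms m_assoc[of "inv (p t)" "p t" "inv (p v)"] by (simp add: p_quot_def m_assoc)

lemma n_p_quot:
  assumes "w \<in> carrier W" "v \<in> carrier W" "u = w \<otimes> v"
  shows "n u \<otimes> p_quot u v = w \<otimes> n v"
proof -
  have "inv (p u) \<otimes> (p u \<otimes> inv (p v)) = inv (p v)"
    using assms m_assoc[of "inv (p u)" "p u" "inv (p v)"] by simp
  then show ?thesis
    using assms by (simp add: coset_n_def p_quot_def m_assoc)
qed

lemma nu_p_quot_iso:
  "\<lbrakk>u \<in> carrier W; v \<in> carrier W; A \<in> Obj (C (p v))\<rbrakk>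
    \<Longrightarrow> is_iso (C u) (\<nu> (n u) (p_quot u v) (p v) A)"
  unfolding p_quot_def using nu_n_iso p_in by simp

text \<open>
  The extended structure morphism at \<open>(w, v)\<close>.  The product \<open>u = w v\<close> is a separate argument, so that
  no reassociation is needed when it arises from another factorization.
\<close>

definition shriek_map :: "('w \<Rightarrow> 'o) \<Rightarrow> ('w \<times> 'w \<Rightarrow> 'a) \<Rightarrow> 'w \<Rightarrow> 'w \<Rightarrow> 'w \<Rightarrow> 'a" where
  "shriek_map A \<alpha> u w v = FArr (\<Phi> (n u) (p u)) (\<alpha> (p_quot u v, p v))
     \<cdot>\<^bsub>C u\<^esub> inverse_arr (C u) (\<nu> (n u) (p_quot u v) (p v) (A (p v)))
     \<cdot>\<^bsub>C u\<^esub> \<nu> w (n v) (p v) (A (p v))"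

lemma j_shriek_obj_eq:
  "j_shriek_obj W S C \<Phi> \<nu> P (A, \<alpha>) =
    (\<lambda>w\<in>carrier W. FObj (\<Phi> (n w) (p w)) (A (p w)),
     \<lambda>(w, v)\<in>glue_index W (carrier W). shriek_map A \<alpha> (w \<otimes> v) w v)"
  by (simp add: j_shriek_obj_def shriek_map_def p_quot_def Let_def)

context
  fixes A \<alpha>
  assumes X: "(A, \<alpha>) \<in> glue_objects W C \<Phi> \<nu> P"
begin

lemma comp_obj: "w \<in> carrier W \<Longrightarrow> A (p w) \<in> Obj (C (p w))"
  using glue_obj_component[OF X p_in] .

lemma alpha_hom:
  assumes "u \<in> carrier W" "v \<in> carrier W"
  shows "\<alpha> (p_quot u v, p v) \<in> Hom (C (p u)) (FObj (\<Phi> (p_quot u v) (p v)) (A (p v))) (A (p u))"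
  using assms by (intro glue_obj_hom[OF X]) (auto simp: p_quot_p p_in)

lemma shriek_parts_hom:
  assumes w: "w \<in> carrier W" "v \<in> carrier W" "u = w \<otimes> v"
  shows "FArr (\<Phi> (n u) (p u)) (\<alpha> (p_quot u v, p v)) \<in> Hom (C u)
      (FObj (\<Phi> (n u) (p u)) (FObj (\<Phi> (p_quot u v) (p v)) (A (p v)))) (FObj (\<Phi> (n u) (p u)) (A (p u)))"
    and "\<nu> (n u) (p_quot u v) (p v) (A (p v)) \<in> Hom (C u)
      (FObj (\<Phi> (n u) (p u)) (FObj (\<Phi> (p_quot u v) (p v)) (A (p v)))) (FObj (\<Phi> (w \<otimes> n v) (p v)) (A (p v)))"
    and "inverse_arr (C u) (\<nu> (n u) (p_quot u v) (p v) (A (p v))) \<in> Hom (C u)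
      (FObj (\<Phi> (w \<otimes> n v) (p v)) (A (p v))) (FObj (\<Phi> (n u) (p u)) (FObj (\<Phi> (p_quot u v) (p v)) (A (p v))))"
    and "\<nu> w (n v) (p v) (A (p v)) \<in> Hom (C u)
      (FObj (\<Phi> w v) (FObj (\<Phi> (n v) (p v)) (A (p v)))) (FObj (\<Phi> (w \<otimes> n v) (p v)) (A (p v)))"
proof -
  have u: "u \<in> carrier W" using w by simp
  show "FArr (\<Phi> (n u) (p u)) (\<alpha> (p_quot u v, p v)) \<in> Hom (C u)
      (FObj (\<Phi> (n u) (p u)) (FObj (\<Phi> (p_quot u v) (p v)) (A (p v)))) (FObj (\<Phi> (n u) (p u)) (A (p u)))"
    using w u by (intro Phi_hom alpha_hom) (auto simp: n_p)
  show nu: "\<nu> (n u) (p_quot u v) (p v) (A (p v)) \<in> Hom (C u)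
      (FObj (\<Phi> (n u) (p u)) (FObj (\<Phi> (p_quot u v) (p v)) (A (p v)))) (FObj (\<Phi> (w \<otimes> n v) (p v)) (A (p v)))"
    using w u n_p_quot[OF w] by (intro nu_hom comp_obj) (auto simp: n_p p_quot_p)
  show "inverse_arr (C u) (\<nu> (n u) (p_quot u v) (p v) (A (p v))) \<in> Hom (C u)
      (FObj (\<Phi> (w \<otimes> n v) (p v)) (A (p v))) (FObj (\<Phi> (n u) (p u)) (FObj (\<Phi> (p_quot u v) (p v)) (A (p v))))"
    using w u by (intro category.inverse_arr_hom(1)[OF category_C _ nu] nu_p_quot_iso comp_obj)
  show "\<nu> w (n v) (p v) (A (p v)) \<in> Hom (C u)
      (FObj (\<Phi> w v) (FObj (\<Phi> (n v) (p v)) (A (p v)))) (FObj (\<Phi> (w \<otimes> n v) (p v)) (A (p v)))"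
    using w u by (intro nu_hom comp_obj) (auto simp: n_p)
qed

lemma shriek_map_hom:
  assumes w: "w \<in> carrier W" "v \<in> carrier W" "u = w \<otimes> v"
  shows "shriek_map A \<alpha> u w v \<in> Hom (C u)
    (FObj (\<Phi> w v) (FObj (\<Phi> (n v) (p v)) (A (p v)))) (FObj (\<Phi> (n u) (p u)) (A (p u)))"
proof -
  have u: "u \<in> carrier W" using w by simp
  interpret category "C u" by (rule category_C[OF u])
  show ?thesis
    unfolding shriek_map_def
    using shriek_parts_hom[OF w] cmp_closed by blast
qed

text \<open>
  Here \<open>w\<^sub>1 = 1\<close>, so the image of \<open>\<alpha>\<close> and the inverted \<open>\<nu>\<close> are identities.  The case \<open>w = 1\<close> gives the unit
  law of the extended object, the case \<open>v = p(w v)\<close> the reconstruction of a morphism from its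
  components on P.
\<close>

lemma shriek_map_same_p:
  assumes w: "w \<in> carrier W" "v \<in> carrier W" "u = w \<otimes> v" "p u = p v"
  shows "shriek_map A \<alpha> u w v = \<nu> w (n v) (p v) (A (p v))"
proof -
  have u: "u \<in> carrier W" using w by simp
  interpret category "C u" by (rule category_C[OF u])
  have q: "p_quot u v = \<one>"
    using w by (simp add: p_quot_def)
  have n: "n u = w \<otimes> n v"
    using n_p_quot[OF w(1-3)] u by (simp add: q)
  have np: "u = n u \<otimes> p v"
    using n_p[OF u] w by simp
  have o: "FObj (\<Phi> (n u) (p v)) (A (p v)) \<in> Obj (C u)"
    using u w np by (intro Phi_obj comp_obj) auto
  have one: "FArr (\<Phi> (n u) (p u)) (\<alpha> (p_quot u v, p v)) = Idn (C u) (FObj (\<Phi> (n u) (p v)) (A (p v)))"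
    unfolding q w(4) glue_obj_one[OF X p_in[OF w(2)]]
    by (rule Phi_idn[OF n_carrier[OF u] p_carrier[OF w(2)] np comp_obj[OF w(2)]])
  have "\<nu> (n u) (p_quot u v) (p v) (A (p v)) = Idn (C u) (FObj (\<Phi> (n u) (p v)) (A (p v)))"
    unfolding q using nu_one_right[OF n_carrier[OF u] p_carrier[OF w(2)] comp_obj[OF w(2)]]
    by (simp only: np[symmetric])
  then have inv: "inverse_arr (C u) (\<nu> (n u) (p_quot u v) (p v) (A (p v)))
      = Idn (C u) (FObj (\<Phi> (n u) (p v)) (A (p v)))"
    using inverse_arr_idn[OF o] by simp
  show ?thesis
    unfolding shriek_map_def one inv
    using cmp_idn_left[OF idn_closed[OF o]] cmp_idn_left[OF shriek_parts_hom(4)[OF w(1-3)]] by (simp add: n)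
qed

text \<open>
  Every structure morphism is a composition of a functor image, an inverted \<open>\<nu>\<close> and a \<open>\<nu>\<close>.  Naturality
  of \<open>\<nu>\<close> moves the two functor images of \<open>\<alpha>\<close> next to each other, where the associativity of \<open>\<alpha>\<close> merges
  them; the cocycle condition for \<open>\<nu>\<close>, used three times, merges the remaining factors.
\<close>

lemma shriek_map_assoc:
  assumes w: "w \<in> carrier W" "w' \<in> carrier W" "v \<in> carrier W" "t = w' \<otimes> v" "z = w \<otimes> w'" "u = w \<otimes> t"
  shows "shriek_map A \<alpha> u w t \<cdot>\<^bsub>C u\<^esub> FArr (\<Phi> w t) (shriek_map A \<alpha> t w' v)
    = shriek_map A \<alpha> u z v \<cdot>\<^bsub>C u\<^esub> \<nu> w w' v (FObj (\<Phi> (n v) (p v)) (A (p v)))"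
proof -
  have t: "t \<in> carrier W" and u: "u \<in> carrier W" and z: "z \<in> carrier W" "u = z \<otimes> v"
    using w by (auto simp: m_assoc)
  interpret category "C u" by (rule category_C[OF u])
  define a where "a = p_quot t v"
  define b where "b = p_quot u t"
  define d where "d = p_quot u v"
  define A0 where "A0 = A (p v)"
  define A1 where "A1 = A (p t)"
  define g where "g = w \<otimes> n t"
  define h where "h = w' \<otimes> n v"
  have car: "a \<in> carrier W" "b \<in> carrier W" "d \<in> carrier W" "g \<in> carrier W" "h \<in> carrier W"
    using w t u by (auto simp: a_def b_def d_def g_def h_def)
  have ap: "p t = a \<otimes> p v" "p u = b \<otimes> p t" "p u = d \<otimes> p v"
    using w t u by (simp_all add: a_def b_def d_def p_quot_p)
  have np: "v = n v \<otimes> p v" "t = n t \<otimes> p t" "u = n u \<otimes> p u"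
    using w t u by (simp_all add: n_p)
  have ng: "g = n u \<otimes> b" "h = n t \<otimes> a" and nd: "z \<otimes> n v = n u \<otimes> d"
    using n_p_quot[OF w(1) t w(6)] n_p_quot[OF w(2,3,4)] n_p_quot[OF z(1) w(3) z(2)]
    by (simp_all add: g_def h_def a_def b_def d_def)
  have d: "d = b \<otimes> a"
    using p_quot_mult[OF u t w(3)] by (simp add: a_def b_def d_def)
  have dh: "n u \<otimes> d = w \<otimes> h" "n u \<otimes> d = g \<otimes> a"
    using w(1,2,3) u car(1,2) by (simp add: nd[symmetric] h_def w(5) m_assoc, simp add: d ng m_assoc)
  have th: "t = h \<otimes> p v"
    using w by (simp add: h_def m_assoc n_p)
  have obj: "A0 \<in> Obj (C (p v))" "A1 \<in> Obj (C (p t))" "FObj (\<Phi> a (p v)) A0 \<in> Obj (C (p t))"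
    unfolding A0_def A1_def
    by (rule comp_obj[OF w(3)], rule comp_obj[OF t],
        rule Phi_obj[OF car(1) p_carrier[OF w(3)] ap(1) comp_obj[OF w(3)]])
  note N = n_carrier[OF w(3)] n_carrier[OF t] n_carrier[OF u]
  note Pc = p_carrier[OF w(3)] p_carrier[OF t] p_carrier[OF u]
  have aA: "\<alpha> (a, p v) \<in> Hom (C (p t)) (FObj (\<Phi> a (p v)) A0) A1"
    and bA: "\<alpha> (b, p t) \<in> Hom (C (p u)) (FObj (\<Phi> b (p t)) A1) (A (p u))"
    and dA: "\<alpha> (d, p v) \<in> Hom (C (p u)) (FObj (\<Phi> d (p v)) A0) (A (p u))"
    unfolding a_def b_def d_def A0_def A1_def using w t u alpha_hom by auto
  have nuab: "\<nu> b a (p v) A0 \<in> Hom (C (p u)) (FObj (\<Phi> b (p t)) (FObj (\<Phi> a (p v)) A0)) (FObj (\<Phi> d (p v)) A0)"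
    by (rule nu_hom[OF car(2,1) Pc(1) ap(1) d ap(2) obj(1)])
  note parts_t = shriek_parts_hom[OF w(2,3,4), folded a_def A0_def A1_def h_def]
  note parts_u = shriek_parts_hom[OF w(1) t w(6), folded b_def A1_def g_def]
  note parts_z = shriek_parts_hom[OF z(1) w(3) z(2), folded d_def A0_def, unfolded nd]
  note iso_b = nu_p_quot_iso[OF u t, folded b_def]
  have iso_d: "is_iso (C u) (\<nu> (n u) d (p v) A0)"
    using nu_p_quot_iso[OF u w(3)] obj by (simp add: d_def)
  have iso_a: "is_iso (C t) (\<nu> (n t) a (p v) A0)"
    using nu_p_quot_iso[OF t w(3)] obj by (simp add: a_def)
  have shr: "shriek_map A \<alpha> t w' v = FArr (\<Phi> (n t) (p t)) (\<alpha> (a, p v))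
      \<cdot>\<^bsub>C t\<^esub> inverse_arr (C t) (\<nu> (n t) a (p v) A0) \<cdot>\<^bsub>C t\<^esub> \<nu> w' (n v) (p v) A0"
    by (simp add: shriek_map_def a_def A0_def)

  \<comment> \<open>The left side is \<open>q i l r j s\<close>, the right side is \<open>c i3 e e'\<close>; the other arrows appear in between.\<close>
  define q where "q = FArr (\<Phi> (n u) (p u)) (\<alpha> (b, p t))"
  define i where "i = inverse_arr (C u) (\<nu> (n u) b (p t) A1)"
  define l where "l = \<nu> w (n t) (p t) A1"
  define r where "r = FArr (\<Phi> w t) (FArr (\<Phi> (n t) (p t)) (\<alpha> (a, p v)))"
  define j where "j = FArr (\<Phi> w t) (inverse_arr (C t) (\<nu> (n t) a (p v) A0))"
  define s where "s = FArr (\<Phi> w t) (\<nu> w' (n v) (p v) A0)"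
  define r' where "r' = FArr (\<Phi> g (p t)) (\<alpha> (a, p v))"
  define l' where "l' = \<nu> w (n t) (p t) (FObj (\<Phi> a (p v)) A0)"
  define r'' where "r'' = FArr (\<Phi> (n u) (p u)) (FArr (\<Phi> b (p t)) (\<alpha> (a, p v)))"
  define i' where "i' = inverse_arr (C u) (\<nu> (n u) b (p t) (FObj (\<Phi> a (p v)) A0))"
  define c where "c = FArr (\<Phi> (n u) (p u)) (\<alpha> (d, p v))"
  define k where "k = FArr (\<Phi> (n u) (p u)) (\<nu> b a (p v) A0)"
  define i3 where "i3 = inverse_arr (C u) (\<nu> (n u) d (p v) A0)"
  define m where "m = \<nu> g a (p v) A0"
  define y where "y = \<nu> w h (p v) A0"
  define y' where "y' = FArr (\<Phi> w t) (\<nu> (n t) a (p v) A0)"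
  define e where "e = \<nu> z (n v) (p v) A0"
  define e' where "e' = \<nu> w w' v (FObj (\<Phi> (n v) (p v)) A0)"

  have hom_b: "\<nu> (n u) b (p t) A1 \<in> Hom (C u) (FObj (\<Phi> (n u) (p u)) (FObj (\<Phi> b (p t)) A1)) (FObj (\<Phi> g (p t)) A1)"
    by (rule parts_u(2))
  have hom_b': "\<nu> (n u) b (p t) (FObj (\<Phi> a (p v)) A0) \<in> Hom (C u)
      (FObj (\<Phi> (n u) (p u)) (FObj (\<Phi> b (p t)) (FObj (\<Phi> a (p v)) A0))) (FObj (\<Phi> g (p t)) (FObj (\<Phi> a (p v)) A0))"
    by (rule nu_hom[OF N(3) car(2) Pc(2) ap(2) ng(1) np(3) obj(3)])
  have ug: "u = g \<otimes> p t" using w t by (simp add: g_def m_assoc n_p)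
  have hom_q: "q \<in> Hom (C u) (FObj (\<Phi> (n u) (p u)) (FObj (\<Phi> b (p t)) A1)) (FObj (\<Phi> (n u) (p u)) (A (p u)))"
    unfolding q_def by (rule parts_u(1))
  have hom_i: "i \<in> Hom (C u) (FObj (\<Phi> g (p t)) A1) (FObj (\<Phi> (n u) (p u)) (FObj (\<Phi> b (p t)) A1))"
    unfolding i_def by (rule parts_u(3))
  have hom_l: "l \<in> Hom (C u) (FObj (\<Phi> w t) (FObj (\<Phi> (n t) (p t)) A1)) (FObj (\<Phi> g (p t)) A1)"
    unfolding l_def by (rule parts_u(4))
  have hom_r: "r \<in> Hom (C u) (FObj (\<Phi> w t) (FObj (\<Phi> (n t) (p t)) (FObj (\<Phi> a (p v)) A0))) (FObj (\<Phi> w t) (FObj (\<Phi> (n t) (p t)) A1))"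
    unfolding r_def by (rule Phi_hom[OF w(1) t w(6) parts_t(1)])
  have hom_j: "j \<in> Hom (C u) (FObj (\<Phi> w t) (FObj (\<Phi> h (p v)) A0)) (FObj (\<Phi> w t) (FObj (\<Phi> (n t) (p t)) (FObj (\<Phi> a (p v)) A0)))"
    unfolding j_def by (rule Phi_hom[OF w(1) t w(6) parts_t(3)])
  have hom_s: "s \<in> Hom (C u) (FObj (\<Phi> w t) (FObj (\<Phi> w' v) (FObj (\<Phi> (n v) (p v)) A0))) (FObj (\<Phi> w t) (FObj (\<Phi> h (p v)) A0))"
    unfolding s_def by (rule Phi_hom[OF w(1) t w(6) parts_t(4)])
  have hom_r': "r' \<in> Hom (C u) (FObj (\<Phi> g (p t)) (FObj (\<Phi> a (p v)) A0)) (FObj (\<Phi> g (p t)) A1)"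
    unfolding r'_def by (rule Phi_hom[OF car(4) Pc(2) ug aA])
  have hom_l': "l' \<in> Hom (C u) (FObj (\<Phi> w t) (FObj (\<Phi> (n t) (p t)) (FObj (\<Phi> a (p v)) A0))) (FObj (\<Phi> g (p t)) (FObj (\<Phi> a (p v)) A0))"
    unfolding l'_def by (rule nu_hom[OF w(1) N(2) Pc(2) np(2) g_def w(6) obj(3)])
  have hom_r'': "r'' \<in> Hom (C u) (FObj (\<Phi> (n u) (p u)) (FObj (\<Phi> b (p t)) (FObj (\<Phi> a (p v)) A0))) (FObj (\<Phi> (n u) (p u)) (FObj (\<Phi> b (p t)) A1))"
    unfolding r''_def by (rule Phi_hom[OF N(3) Pc(3) np(3) Phi_hom[OF car(2) Pc(2) ap(2) aA]])
  have hom_i': "i' \<in> Hom (C u) (FObj (\<Phi> g (p t)) (FObj (\<Phi> a (p v)) A0)) (FObj (\<Phi> (n u) (p u)) (FObj (\<Phi> b (p t)) (FObj (\<Phi> a (p v)) A0)))"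
    unfolding i'_def by (rule inverse_arr_hom(1)[OF iso_b[OF obj(3)] hom_b'])
  have hom_c: "c \<in> Hom (C u) (FObj (\<Phi> (n u) (p u)) (FObj (\<Phi> d (p v)) A0)) (FObj (\<Phi> (n u) (p u)) (A (p u)))"
    unfolding c_def by (rule parts_z(1))
  have hom_k: "k \<in> Hom (C u) (FObj (\<Phi> (n u) (p u)) (FObj (\<Phi> b (p t)) (FObj (\<Phi> a (p v)) A0))) (FObj (\<Phi> (n u) (p u)) (FObj (\<Phi> d (p v)) A0))"
    unfolding k_def by (rule Phi_hom[OF N(3) Pc(3) np(3) nuab])
  have hom_i3: "i3 \<in> Hom (C u) (FObj (\<Phi> (n u \<otimes> d) (p v)) A0) (FObj (\<Phi> (n u) (p u)) (FObj (\<Phi> d (p v)) A0))"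
    unfolding i3_def by (rule parts_z(3))
  have hom_m: "m \<in> Hom (C u) (FObj (\<Phi> g (p t)) (FObj (\<Phi> a (p v)) A0)) (FObj (\<Phi> (n u \<otimes> d) (p v)) A0)"
    unfolding m_def by (rule nu_hom[OF car(4,1) Pc(1) ap(1) dh(2) ug obj(1)])
  have hom_y: "y \<in> Hom (C u) (FObj (\<Phi> w t) (FObj (\<Phi> h (p v)) A0)) (FObj (\<Phi> (n u \<otimes> d) (p v)) A0)"
    unfolding y_def by (rule nu_hom[OF w(1) car(5) Pc(1) th dh(1) w(6) obj(1)])
  have hom_y': "y' \<in> Hom (C u) (FObj (\<Phi> w t) (FObj (\<Phi> (n t) (p t)) (FObj (\<Phi> a (p v)) A0))) (FObj (\<Phi> w t) (FObj (\<Phi> h (p v)) A0))"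
    unfolding y'_def by (rule Phi_hom[OF w(1) t w(6) parts_t(2)])
  have hom_e: "e \<in> Hom (C u) (FObj (\<Phi> z v) (FObj (\<Phi> (n v) (p v)) A0)) (FObj (\<Phi> (n u \<otimes> d) (p v)) A0)"
    unfolding e_def by (rule parts_z(4))
  have hom_e': "e' \<in> Hom (C u) (FObj (\<Phi> w t) (FObj (\<Phi> w' v) (FObj (\<Phi> (n v) (p v)) A0))) (FObj (\<Phi> z v) (FObj (\<Phi> (n v) (p v)) A0))"
    unfolding e'_def by (rule nu_hom[OF w(1,2,3,4,5,6) Phi_obj[OF N(1) Pc(1) np(1) obj(1)]])
  note H = hom_q hom_i hom_l hom_r hom_j hom_s hom_r' hom_l' hom_r''
    hom_i' hom_c hom_k hom_i3 hom_m hom_y hom_y' hom_e hom_e'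
  note [simp] = H[THEN HomD, THEN conjunct1] H[THEN HomD, THEN conjunct2, THEN conjunct1]
    H[THEN HomD, THEN conjunct2, THEN conjunct2]
  \<comment> \<open>Naturality of \<open>\<nu>\<close> moves the inner \<open>\<alpha>\<close> to the left, past \<open>l\<close> and the inverted \<open>i\<close>.\<close>
  have lr: "l \<cdot>\<^bsub>C u\<^esub> r = r' \<cdot>\<^bsub>C u\<^esub> l'"
    unfolding l_def r_def r'_def l'_def by (rule nu_nat[OF w(1) N(2) Pc(2) np(2) g_def w(6) aA])
  have ir: "i \<cdot>\<^bsub>C u\<^esub> r' = r'' \<cdot>\<^bsub>C u\<^esub> i'"
    unfolding i_def i'_def
    by (rule square_invert[OF _ iso_b[OF obj(2)] iso_b[OF obj(3)] hom_b' hom_b hom_r'' hom_r'])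
      (unfold r'_def r''_def, rule nu_nat[OF N(3) car(2) Pc(2) ap(2) ng(1) np(3) aA])
  have "\<alpha> (b, p t) \<cdot>\<^bsub>C (p u)\<^esub> FArr (\<Phi> b (p t)) (\<alpha> (a, p v)) = \<alpha> (d, p v) \<cdot>\<^bsub>C (p u)\<^esub> \<nu> b a (p v) A0"
    unfolding A0_def
    by (rule glue_obj_assoc[OF X P_sub car(2,1) p_in[OF w(3)] ap(1) p_in[OF t] d ap(2) p_in[OF u]])
  then have qr: "q \<cdot>\<^bsub>C u\<^esub> r'' = c \<cdot>\<^bsub>C u\<^esub> k"
    unfolding q_def r''_def c_def k_def
    by (simp add: Phi_cmp[OF N(3) Pc(3) np(3) Phi_hom[OF car(2) Pc(2) ap(2) aA] bA, symmetric]
        Phi_cmp[OF N(3) Pc(3) np(3) nuab dA, symmetric])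
  \<comment> \<open>Three instances of the cocycle condition: for \<open>(n(u), b, a)\<close>, \<open>(w, n(t), a)\<close> and \<open>(w, w', n(v))\<close>.\<close>
  have ki: "i3 \<cdot>\<^bsub>C u\<^esub> m = k \<cdot>\<^bsub>C u\<^esub> i'"
    unfolding i3_def i'_def
    by (rule square_invert[OF _ iso_d iso_b[OF obj(3)] hom_b' parts_z(2) hom_k hom_m])
      (unfold k_def m_def,
        rule nu_cocycle[OF N(3) car(2,1) Pc(1) ap(1,2) np(3) ng(1) d obj(1), symmetric])
  have ml: "m \<cdot>\<^bsub>C u\<^esub> l' = y \<cdot>\<^bsub>C u\<^esub> y'"
    unfolding m_def l'_def y_def y'_def
    by (rule nu_cocycle[OF w(1) N(2) car(1) Pc(1) ap(1) np(2) w(6) g_def ng(2) obj(1)])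
  have yj: "y' \<cdot>\<^bsub>C u\<^esub> j = Idn (C u) (FObj (\<Phi> w t) (FObj (\<Phi> h (p v)) A0))"
    unfolding y'_def j_def
    by (simp add: Phi_cmp[OF w(1) t w(6) parts_t(3,2), symmetric]
        category.inverse_arr_hom(3)[OF category_C[OF t] iso_a parts_t(2)]
        Phi_idn[OF w(1) t w(6) Phi_obj[OF car(5) Pc(1) th obj(1)]])
  have ys: "e \<cdot>\<^bsub>C u\<^esub> e' = y \<cdot>\<^bsub>C u\<^esub> s"
    unfolding y_def s_def e_def e'_def
    by (rule nu_cocycle[OF w(1,2) N(1) Pc(1) np(1) w(4,6,5) h_def obj(1)])
  interpret Ct: category "C t" by (rule category_C[OF t])
  have "FArr (\<Phi> w t) (shriek_map A \<alpha> t w' v) = r \<cdot>\<^bsub>C u\<^esub> j \<cdot>\<^bsub>C u\<^esub> s"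
    unfolding shr r_def j_def s_def
    by (simp add: Phi_cmp[OF w(1) t w(6) parts_t(4) Ct.cmp_closed[OF parts_t(3,1)]]
        Phi_cmp[OF w(1) t w(6) parts_t(3,1)])
  moreover have "shriek_map A \<alpha> u w t = q \<cdot>\<^bsub>C u\<^esub> i \<cdot>\<^bsub>C u\<^esub> l"
    by (simp add: shriek_map_def q_def i_def l_def b_def A1_def)
  moreover have "shriek_map A \<alpha> u z v = c \<cdot>\<^bsub>C u\<^esub> i3 \<cdot>\<^bsub>C u\<^esub> e"
    by (simp add: shriek_map_def c_def i3_def e_def d_def A0_def)
  ultimately have "shriek_map A \<alpha> u w t \<cdot>\<^bsub>C u\<^esub> FArr (\<Phi> w t) (shriek_map A \<alpha> t w' v)
      = q \<cdot>\<^bsub>C u\<^esub> (i \<cdot>\<^bsub>C u\<^esub> (l \<cdot>\<^bsub>C u\<^esub> (r \<cdot>\<^bsub>C u\<^esub> (j \<cdot>\<^bsub>C u\<^esub> s))))"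
    and rhs: "shriek_map A \<alpha> u z v \<cdot>\<^bsub>C u\<^esub> e' = c \<cdot>\<^bsub>C u\<^esub> (i3 \<cdot>\<^bsub>C u\<^esub> (e \<cdot>\<^bsub>C u\<^esub> e'))"
    by (simp_all add: arr_simps)
  note this(1)
  also have "q \<cdot>\<^bsub>C u\<^esub> (i \<cdot>\<^bsub>C u\<^esub> (l \<cdot>\<^bsub>C u\<^esub> (r \<cdot>\<^bsub>C u\<^esub> (j \<cdot>\<^bsub>C u\<^esub> s))))
      = q \<cdot>\<^bsub>C u\<^esub> (r'' \<cdot>\<^bsub>C u\<^esub> (i' \<cdot>\<^bsub>C u\<^esub> (l' \<cdot>\<^bsub>C u\<^esub> (j \<cdot>\<^bsub>C u\<^esub> s))))"
    by (simp add: square_extend[OF lr] square_extend[OF ir] cmp_arr)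
  also have "\<dots> = c \<cdot>\<^bsub>C u\<^esub> (k \<cdot>\<^bsub>C u\<^esub> (i' \<cdot>\<^bsub>C u\<^esub> (l' \<cdot>\<^bsub>C u\<^esub> (j \<cdot>\<^bsub>C u\<^esub> s))))"
    by (simp add: square_extend[OF qr] cmp_arr)
  also have "\<dots> = c \<cdot>\<^bsub>C u\<^esub> (i3 \<cdot>\<^bsub>C u\<^esub> (m \<cdot>\<^bsub>C u\<^esub> (l' \<cdot>\<^bsub>C u\<^esub> (j \<cdot>\<^bsub>C u\<^esub> s))))"
    by (simp add: square_extend[OF ki] cmp_arr)
  also have "\<dots> = c \<cdot>\<^bsub>C u\<^esub> (i3 \<cdot>\<^bsub>C u\<^esub> (y \<cdot>\<^bsub>C u\<^esub> s))"
    by (simp add: square_extend[OF ml] retract_extend[OF yj] cmp_arr)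
  also have "\<dots> = c \<cdot>\<^bsub>C u\<^esub> (i3 \<cdot>\<^bsub>C u\<^esub> (e \<cdot>\<^bsub>C u\<^esub> e'))"
    by (simp add: ys)
  finally show ?thesis
    using rhs by (simp add: e'_def A0_def)
qed

lemma j_shriek_obj_closed: "j_shriek_obj W S C \<Phi> \<nu> P (A, \<alpha>) \<in> glue_objects W C \<Phi> \<nu> (carrier W)"
  unfolding j_shriek_obj_eq
proof (rule glue_objectsI, goal_cases)
  case (4 w)
  then show ?case
    by (auto intro!: Phi_obj comp_obj simp: n_p)
next
  case (5 w v u)
  then show ?case
    using shriek_map_hom[of w v u] by (simp add: glue_index_def)
next
  case (6 w)
  then have "shriek_map A \<alpha> w \<one> w = Idn (C w) (FObj (\<Phi> (n w) (p w)) (A (p w)))"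
    using shriek_map_same_p[of \<one> w w] nu_one_left[of "n w" "p w"] comp_obj by (simp add: n_p)
  then show ?case
    using 6 by (simp add: glue_index_def)
next
  case (7 w w' a v z u)
  then show ?case
    using shriek_map_assoc[of w w' a v z u] by (simp add: glue_index_def m_assoc)
qed auto

lemma j_res_shriek_obj: "j_res_obj W P (j_shriek_obj W S C \<Phi> \<nu> P (A, \<alpha>)) = (A, \<alpha>)"
proof -
  have "FObj (\<Phi> (n w) (p w)) (A (p w)) = A w" if "w \<in> P" for w
    using that glue_obj_component[OF X that] by (simp add: n_one p_id Phi_one_obj)
  moreover have "shriek_map A \<alpha> u w v = \<alpha> (w, v)" if "w \<in> carrier W" "v \<in> P" "u = w \<otimes> v" "u \<in> P" for w v u
  proof -
    have c: "v \<in> carrier W" "u \<in> carrier W" using that by auto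
    interpret category "C u" by (rule category_C[OF c(2)])
    have Av: "A v \<in> Obj (C v)" by (rule glue_obj_component[OF X that(2)])
    have q: "p_quot u v = w"
      using that c by (simp add: p_quot_def p_id m_assoc)
    have h: "\<alpha> (w, v) \<in> Hom (C u) (FObj (\<Phi> w v) (A v)) (A u)"
      by (rule glue_obj_hom[OF X that])
    have o: "FObj (\<Phi> w v) (A v) \<in> Obj (C u)"
      by (rule Phi_obj[OF that(1) c(1) that(3) Av])
    have nu: "\<nu> \<one> w v (A v) = Idn (C u) (FObj (\<Phi> w v) (A v))" "\<nu> w \<one> v (A v) = Idn (C u) (FObj (\<Phi> w v) (A v))"
      using nu_one_left[OF that(1) c(1) Av] nu_one_right[OF that(1) c(1) Av] that by simp_all
    have "FArr (\<Phi> \<one> u) (\<alpha> (w, v)) = \<alpha> (w, v)"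
      using Phi_one_arr[OF c(2)] HomD[OF h] by simp
    then have "shriek_map A \<alpha> u w v = \<alpha> (w, v) \<cdot>\<^bsub>C u\<^esub> Idn (C u) (FObj (\<Phi> w v) (A v)) \<cdot>\<^bsub>C u\<^esub> Idn (C u) (FObj (\<Phi> w v) (A v))"
      unfolding shriek_map_def q n_one[OF that(2)] n_one[OF that(4)] p_id[OF that(2)] p_id[OF that(4)] nu
      using inverse_arr_idn[OF o] by simp
    then show ?thesis
      using cmp_idn_right[OF h] by simp
  qed
  moreover have "A \<in> extensional P" "\<alpha> \<in> extensional (glue_index W P)"
    using X by (auto simp: glue_objects_def)
  ultimately show ?thesis
    unfolding j_res_obj_def j_shriek_obj_eq
    by (auto simp: glue_index_def intro!: extensionalityI[where A = P] extensionalityI[where A = "glue_index W P"])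
qed

end

lemma shriek_arr_square:
  assumes f: "((A, \<alpha>), (B, \<beta>), f) \<in> glue_arrows W C \<Phi> \<nu> P"
    and w: "w \<in> carrier W" "v \<in> carrier W" "u = w \<otimes> v"
  shows "FArr (\<Phi> (n u) (p u)) (f (p u)) \<cdot>\<^bsub>C u\<^esub> shriek_map A \<alpha> u w v
    = shriek_map B \<beta> u w v \<cdot>\<^bsub>C u\<^esub> FArr (\<Phi> w v) (FArr (\<Phi> (n v) (p v)) (f (p v)))"
proof -
  have u: "u \<in> carrier W" using w by simp
  interpret category "C u" by (rule category_C[OF u])
  have X: "(A, \<alpha>) \<in> glue_objects W C \<Phi> \<nu> P" and Y: "(B, \<beta>) \<in> glue_objects W C \<Phi> \<nu> P"
    using f by (auto simp: glue_arrows_def)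
  define d where "d = p_quot u v"
  have d: "d \<in> carrier W" "p u = d \<otimes> p v"
    using w u by (simp_all add: d_def p_quot_p)
  have g: "w \<otimes> n v = n u \<otimes> d"
    using n_p_quot[OF w] by (simp add: d_def)
  have g': "w \<otimes> n v \<in> carrier W" "u = w \<otimes> n v \<otimes> p v"
    using w by (simp_all add: m_assoc n_p)
  note np = n_p[OF u, symmetric] n_p[OF w(2), symmetric]
  note N = n_carrier[OF u] n_carrier[OF w(2)] p_carrier[OF u] p_carrier[OF w(2)]
  note fv = glue_arr_hom[OF f p_in[OF w(2)]] and fu = glue_arr_hom[OF f p_in[OF u]]
  note partsA = shriek_parts_hom[OF X w, folded d_def]
    and partsB = shriek_parts_hom[OF Y w, folded d_def]
  define i where "i = inverse_arr (C u) (\<nu> (n u) d (p v) (A (p v)))"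
  define i' where "i' = inverse_arr (C u) (\<nu> (n u) d (p v) (B (p v)))"
  note dfv = Phi_hom[OF d(1) N(4) d(2) fv]
  note H = Phi_hom[OF N(1,3) np(1) fu] partsA(1,4) partsA(3)[folded i_def]
    partsB(1,4) partsB(3)[folded i'_def]
    Phi_hom[OF N(1,3) np(1) dfv] Phi_hom[OF g'(1) N(4) g'(2) fv]
    Phi_hom[OF w Phi_hom[OF N(2,4) np(2) fv]]
  note [simp] = H[THEN HomD, THEN conjunct1] H[THEN HomD, THEN conjunct2, THEN conjunct1]
    H[THEN HomD, THEN conjunct2, THEN conjunct2]
  have "f (p u) \<cdot>\<^bsub>C (p u)\<^esub> \<alpha> (d, p v) = \<beta> (d, p v) \<cdot>\<^bsub>C (p u)\<^esub> FArr (\<Phi> d (p v)) (f (p v))"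
    by (rule glue_arr_square[OF f d(1) p_in[OF w(2)] d(2) p_in[OF u]])
  then have 1: "FArr (\<Phi> (n u) (p u)) (f (p u)) \<cdot>\<^bsub>C u\<^esub> FArr (\<Phi> (n u) (p u)) (\<alpha> (d, p v))
      = FArr (\<Phi> (n u) (p u)) (\<beta> (d, p v)) \<cdot>\<^bsub>C u\<^esub> FArr (\<Phi> (n u) (p u)) (FArr (\<Phi> d (p v)) (f (p v)))"
    by (simp add: Phi_cmp[OF N(1,3) np(1) alpha_hom[OF X u w(2), folded d_def] fu, symmetric]
        Phi_cmp[OF N(1,3) np(1) dfv alpha_hom[OF Y u w(2), folded d_def], symmetric])
  have 2: "i' \<cdot>\<^bsub>C u\<^esub> FArr (\<Phi> (w \<otimes> n v) (p v)) (f (p v))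
      = FArr (\<Phi> (n u) (p u)) (FArr (\<Phi> d (p v)) (f (p v))) \<cdot>\<^bsub>C u\<^esub> i"
    unfolding i_def i'_def
  proof (rule square_invert[OF _ _ _ partsA(2) partsB(2)])
    show "is_iso (C u) (\<nu> (n u) d (p v) (B (p v)))" "is_iso (C u) (\<nu> (n u) d (p v) (A (p v)))"
      unfolding d_def by (rule nu_p_quot_iso[OF u w(2) comp_obj[OF Y w(2)]],
          rule nu_p_quot_iso[OF u w(2) comp_obj[OF X w(2)]])
  qed (rule nu_nat[OF N(1) d(1) N(4) d(2) g np(1) fv] H)+
  have 3: "\<nu> w (n v) (p v) (B (p v)) \<cdot>\<^bsub>C u\<^esub> FArr (\<Phi> w v) (FArr (\<Phi> (n v) (p v)) (f (p v)))
      = FArr (\<Phi> (w \<otimes> n v) (p v)) (f (p v)) \<cdot>\<^bsub>C u\<^esub> \<nu> w (n v) (p v) (A (p v))"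
    by (rule nu_nat[OF w(1) N(2,4) np(2) HOL.refl w(3) fv])
  show ?thesis
    unfolding shriek_map_def d_def[symmetric] i_def[symmetric] i'_def[symmetric]
    by (simp add: arr_simps square_extend[OF 1] square_extend[OF 2] 3)
qed

lemma j_shriek_arrow:
  assumes f: "((A, \<alpha>), (B, \<beta>), f) \<in> glue_arrows W C \<Phi> \<nu> P"
  shows "(j_shriek_obj W S C \<Phi> \<nu> P (A, \<alpha>), j_shriek_obj W S C \<Phi> \<nu> P (B, \<beta>),
    \<lambda>w\<in>carrier W. FArr (\<Phi> (n w) (p w)) (f (p w))) \<in> glue_arrows W C \<Phi> \<nu> (carrier W)"
proof -
  have X: "(A, \<alpha>) \<in> glue_objects W C \<Phi> \<nu> P" and Y: "(B, \<beta>) \<in> glue_objects W C \<Phi> \<nu> P"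
    using f by (auto simp: glue_arrows_def)
  have "FArr (\<Phi> (n w) (p w)) (f (p w))
      \<in> Hom (C w) (FObj (\<Phi> (n w) (p w)) (A (p w))) (FObj (\<Phi> (n w) (p w)) (B (p w)))"
    if "w \<in> carrier W" for w
    using that by (intro Phi_hom glue_arr_hom[OF f p_in]) (auto simp: n_p)
  then show ?thesis
    using j_shriek_obj_closed[OF X] j_shriek_obj_closed[OF Y] shriek_arr_square[OF f]
    unfolding j_shriek_obj_eq by (auto simp: glue_arrows_def glue_index_def)
qed

lemma j_shriek_functor: "is_functor glueP glueW (j_shriek W S C \<Phi> \<nu> P)"
proof -
  interpret G: category glueP by (rule glue_category[OF P_sub])
  interpret H: category glueW by (rule glue_category) simp
  show ?thesis
  proof
    fix X assume "X \<in> Obj glueP"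
    then show "FObj (j_shriek W S C \<Phi> \<nu> P) X \<in> Obj glueW"
      using j_shriek_obj_closed by (cases X) (simp add: j_shriek_def)
  next
    fix f X Y assume "f \<in> Hom glueP X Y"
    then show "FArr (j_shriek W S C \<Phi> \<nu> P) f
        \<in> Hom glueW (FObj (j_shriek W S C \<Phi> \<nu> P) X) (FObj (j_shriek W S C \<Phi> \<nu> P) Y)"
      using j_shriek_arrow by (cases X, cases Y) (auto simp: glue_hom_iff j_shriek_def)
  next
    fix X assume "X \<in> Obj glueP"
    moreover obtain A \<alpha> where X: "X = (A, \<alpha>)" by force
    ultimately have "FArr (\<Phi> (n w) (p w)) (Idn (C (p w)) (A (p w)))
        = Idn (C w) (FObj (\<Phi> (n w) (p w)) (A (p w)))" if "w \<in> carrier W" for w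
      using that comp_obj by (intro Phi_idn) (auto simp: n_p)
    then show "FArr (j_shriek W S C \<Phi> \<nu> P) (Idn glueP X) = Idn glueW (FObj (j_shriek W S C \<Phi> \<nu> P) X)"
      using p_in by (auto simp: X j_shriek_def j_shriek_obj_eq intro!: restrict_ext)
  next
    fix f g X Y Z assume "f \<in> Hom glueP X Y" "g \<in> Hom glueP Y Z"
    moreover obtain A \<alpha> B \<beta> D \<delta> where X: "X = (A, \<alpha>)" "Y = (B, \<beta>)" "Z = (D, \<delta>)"
      by (cases X, cases Y, cases Z) simp
    ultimately obtain f' g' where f: "f = (X, Y, f')" "((A, \<alpha>), (B, \<beta>), f') \<in> glue_arrows W C \<Phi> \<nu> P"
      and g: "g = (Y, Z, g')" "((B, \<beta>), (D, \<delta>), g') \<in> glue_arrows W C \<Phi> \<nu> P"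
      by (auto simp: glue_hom_iff)
    have "FArr (\<Phi> (n w) (p w)) (g' (p w) \<cdot>\<^bsub>C (p w)\<^esub> f' (p w))
        = FArr (\<Phi> (n w) (p w)) (g' (p w)) \<cdot>\<^bsub>C w\<^esub> FArr (\<Phi> (n w) (p w)) (f' (p w))"
      if "w \<in> carrier W" for w
      using that glue_arr_hom[OF f(2) p_in[OF that]] glue_arr_hom[OF g(2) p_in[OF that]]
      by (intro Phi_cmp) (auto simp: n_p)
    then show "FArr (j_shriek W S C \<Phi> \<nu> P) (g \<cdot>\<^bsub>glueP\<^esub> f)
        = FArr (j_shriek W S C \<Phi> \<nu> P) g \<cdot>\<^bsub>glueW\<^esub> FArr (j_shriek W S C \<Phi> \<nu> P) f"
      using p_in by (auto simp: f(1) g(1) j_shriek_def intro!: restrict_ext)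
  qed
qed

section \<open>The adjunction\<close>

lemma j_res_shriek_arr:
  assumes "f \<in> Hom glueP X Y"
  shows "FArr (j_res W P) (FArr (j_shriek W S C \<Phi> \<nu> P) f) = f"
proof -
  obtain A \<alpha> B \<beta> where X: "X = (A, \<alpha>)" "Y = (B, \<beta>)"
    by (cases X, cases Y) simp
  then obtain f' where f: "f = (X, Y, f')" "((A, \<alpha>), (B, \<beta>), f') \<in> glue_arrows W C \<Phi> \<nu> P"
    using assms by (auto simp: glue_hom_iff)
  then have "(A, \<alpha>) \<in> glue_objects W C \<Phi> \<nu> P" "(B, \<beta>) \<in> glue_objects W C \<Phi> \<nu> P"
    and ext: "f' \<in> extensional P"
    by (auto simp: glue_arrows_def)
  moreover have "FArr (\<Phi> (n w) (p w)) (f' (p w)) = f' w" if "w \<in> P" for w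
    using that HomD[OF glue_arr_hom[OF f(2) that]] by (simp add: n_one p_id Phi_one_arr)
  ultimately show ?thesis
    unfolding f(1) j_res_def j_shriek_def
    by (auto simp: X j_res_shriek_obj intro!: extensionalityI[where A = P])
qed

text \<open>
  The structure morphism of the extended object at \<open>(n(w), p(w))\<close> is an identity, so the square of h at this
  pair expresses the component at w through the one at \<open>p(w)\<close>.
\<close>

lemma shriek_hom_component:
  assumes X: "(A, \<alpha>) \<in> glue_objects W C \<Phi> \<nu> P"
    and h: "(j_shriek_obj W S C \<Phi> \<nu> P (A, \<alpha>), (B, \<beta>), h) \<in> glue_arrows W C \<Phi> \<nu> (carrier W)"
    and w: "w \<in> carrier W"
  shows "h w = \<beta> (n w, p w) \<cdot>\<^bsub>C w\<^esub> FArr (\<Phi> (n w) (p w)) (h (p w))"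
proof -
  interpret category "C w" by (rule category_C[OF w])
  note c = n_carrier[OF w] p_carrier[OF w]
  note np = n_p[OF w, symmetric]
  have pp: "p (p w) = p w" "n (p w) = \<one>"
    using p_id[OF p_in[OF w]] n_one[OF p_in[OF w]] by simp_all
  have "shriek_map A \<alpha> w (n w) (p w) = Idn (C w) (FObj (\<Phi> (n w) (p w)) (A (p w)))"
    using shriek_map_same_p[OF X c np] pp c n_p[OF w] nu_one_right[OF c comp_obj[OF X w]] by simp
  moreover have "h w \<in> Hom (C w) (FObj (\<Phi> (n w) (p w)) (A (p w))) (B w)"
    using h w by (auto simp: glue_arrows_def j_shriek_obj_eq)
  ultimately have "h w \<cdot>\<^bsub>C w\<^esub> shriek_map A \<alpha> w (n w) (p w) = h w"
    by (simp add: cmp_idn_right)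
  moreover have "h w \<cdot>\<^bsub>C w\<^esub> shriek_map A \<alpha> w (n w) (p w) = \<beta> (n w, p w) \<cdot>\<^bsub>C w\<^esub> FArr (\<Phi> (n w) (p w)) (h (p w))"
    using glue_arr_square[OF h[unfolded j_shriek_obj_eq] c np w] c w
    by (simp add: glue_index_def n_p)
  ultimately show ?thesis by simp
qed

text \<open>
  Both composites of the required square equal \<open>\<beta>\<close> at \<open>(w n(v), p(v))\<close> after \<open>\<Phi>\<close> applied to f at \<open>p(v)\<close>, after
  \<open>\<nu>\<close>: on one side the associativity of \<open>\<beta>\<close> brings in \<open>\<nu>\<close> for the product \<open>n(u) w\<^sub>1 = w n(v)\<close>, which cancels
  the inverted factor, on the other side it brings in \<open>\<nu>\<close> for \<open>w\<close> and \<open>n(v)\<close>.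
\<close>

lemma extend_hom:
  assumes X: "(A, \<alpha>) \<in> glue_objects W C \<Phi> \<nu> P" and Y: "(B, \<beta>) \<in> glue_objects W C \<Phi> \<nu> (carrier W)"
    and f: "((A, \<alpha>), j_res_obj W P (B, \<beta>), f) \<in> glue_arrows W C \<Phi> \<nu> P"
  shows "(j_shriek_obj W S C \<Phi> \<nu> P (A, \<alpha>), (B, \<beta>),
    \<lambda>w\<in>carrier W. \<beta> (n w, p w) \<cdot>\<^bsub>C w\<^esub> FArr (\<Phi> (n w) (p w)) (f (p w))) \<in> glue_arrows W C \<Phi> \<nu> (carrier W)"
proof -
  have fhom: "f w \<in> Hom (C w) (A w) (B w)" if "w \<in> P" for w
    using f that by (auto simp: glue_arrows_def j_res_obj_def)
  have fsq: "f u \<cdot>\<^bsub>C u\<^esub> \<alpha> (w, v) = \<beta> (w, v) \<cdot>\<^bsub>C u\<^esub> FArr (\<Phi> w v) (f v)"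
    if "w \<in> carrier W" "v \<in> P" "u = w \<otimes> v" "u \<in> P" for w v u
    using glue_arr_square[OF f[unfolded j_res_obj_def] that] that by (simp add: glue_index_def)
  have parts: "FArr (\<Phi> (n w) (p w)) (f (p w)) \<in> Hom (C w) (FObj (\<Phi> (n w) (p w)) (A (p w))) (FObj (\<Phi> (n w) (p w)) (B (p w)))"
    "\<beta> (n w, p w) \<in> Hom (C w) (FObj (\<Phi> (n w) (p w)) (B (p w))) (B w)" if "w \<in> carrier W" for w
    using that by (auto intro!: Phi_hom fhom p_in glue_obj_hom[OF Y] simp: n_p)
  have hom: "\<beta> (n w, p w) \<cdot>\<^bsub>C w\<^esub> FArr (\<Phi> (n w) (p w)) (f (p w)) \<in> Hom (C w) (FObj (\<Phi> (n w) (p w)) (A (p w))) (B w)"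
    if "w \<in> carrier W" for w
    using category.cmp_closed[OF category_C[OF that] parts[OF that]] .
  have sq: "\<beta> (n u, p u) \<cdot>\<^bsub>C u\<^esub> FArr (\<Phi> (n u) (p u)) (f (p u)) \<cdot>\<^bsub>C u\<^esub> shriek_map A \<alpha> u w v
      = \<beta> (w, v) \<cdot>\<^bsub>C u\<^esub> FArr (\<Phi> w v) (\<beta> (n v, p v) \<cdot>\<^bsub>C v\<^esub> FArr (\<Phi> (n v) (p v)) (f (p v)))"
    if w: "w \<in> carrier W" "v \<in> carrier W" "u = w \<otimes> v" for w v u
  proof -
    have u: "u \<in> carrier W" using w by simp
    interpret category "C u" by (rule category_C[OF u])
    define d where "d = p_quot u v"
    have d: "d \<in> carrier W" "p u = d \<otimes> p v"
      using w u by (simp_all add: d_def p_quot_p)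
    have g: "w \<otimes> n v = n u \<otimes> d"
      using n_p_quot[OF w] by (simp add: d_def)
    have g': "w \<otimes> n v \<in> carrier W" "u = w \<otimes> n v \<otimes> p v"
      using w by (simp_all add: m_assoc n_p)
    note np = n_p[OF u, symmetric] n_p[OF w(2), symmetric]
    note N = n_carrier[OF u] n_carrier[OF w(2)] p_carrier[OF u] p_carrier[OF w(2)]
    note fv = fhom[OF p_in[OF w(2)]] and fu = fhom[OF p_in[OF u]]
    note B = glue_obj_component[OF Y N(4)]
    have bd: "\<beta> (d, p v) \<in> Hom (C (p u)) (FObj (\<Phi> d (p v)) (B (p v))) (B (p u))"
      by (rule glue_obj_hom[OF Y d(1) N(4) d(2) N(3)])
    note dfv = Phi_hom[OF d(1) N(4) d(2) fv]
    note partsA = shriek_parts_hom[OF X w, folded d_def]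
    define i where "i = inverse_arr (C u) (\<nu> (n u) d (p v) (A (p v)))"
    note nuB = nu_hom[OF N(1) d(1) N(4) d(2) g np(1) B] nu_hom[OF w(1) N(2,4) np(2) HOL.refl w(3) B]
    note H = partsA(1,2,4) partsA(3)[folded i_def] parts[OF u]
      Phi_hom[OF N(1,3) np(1) bd] Phi_hom[OF N(1,3) np(1) dfv] Phi_hom[OF g'(1) N(4) g'(2) fv]
      glue_obj_hom[OF Y g'(1) N(4) g'(2) u] glue_obj_hom[OF Y w u]
      Phi_hom[OF w parts(1)[OF w(2)]] Phi_hom[OF w parts(2)[OF w(2)]] nuB
    note [simp] = H[THEN HomD, THEN conjunct1] H[THEN HomD, THEN conjunct2, THEN conjunct1]
      H[THEN HomD, THEN conjunct2, THEN conjunct2]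
    have 1: "FArr (\<Phi> (n u) (p u)) (f (p u)) \<cdot>\<^bsub>C u\<^esub> FArr (\<Phi> (n u) (p u)) (\<alpha> (d, p v))
        = FArr (\<Phi> (n u) (p u)) (\<beta> (d, p v)) \<cdot>\<^bsub>C u\<^esub> FArr (\<Phi> (n u) (p u)) (FArr (\<Phi> d (p v)) (f (p v)))"
      using fsq[OF d(1) p_in[OF w(2)] d(2) p_in[OF u]]
      by (simp add: Phi_cmp[OF N(1,3) np(1) alpha_hom[OF X u w(2), folded d_def] fu, symmetric]
          Phi_cmp[OF N(1,3) np(1) dfv bd, symmetric])
    have 2: "\<beta> (n u, p u) \<cdot>\<^bsub>C u\<^esub> FArr (\<Phi> (n u) (p u)) (\<beta> (d, p v))
        = \<beta> (w \<otimes> n v, p v) \<cdot>\<^bsub>C u\<^esub> \<nu> (n u) d (p v) (B (p v))"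
      by (rule glue_obj_assoc[OF Y _ N(1) d(1) N(4) d(2) N(3) g np(1) u]) simp
    have 3: "\<nu> (n u) d (p v) (B (p v)) \<cdot>\<^bsub>C u\<^esub> FArr (\<Phi> (n u) (p u)) (FArr (\<Phi> d (p v)) (f (p v)))
        = FArr (\<Phi> (w \<otimes> n v) (p v)) (f (p v)) \<cdot>\<^bsub>C u\<^esub> \<nu> (n u) d (p v) (A (p v))"
      by (rule nu_nat[OF N(1) d(1) N(4) d(2) g np(1) fv])
    have iso: "is_iso (C u) (\<nu> (n u) d (p v) (A (p v)))"
      unfolding d_def by (rule nu_p_quot_iso[OF u w(2) comp_obj[OF X w(2)]])
    have 4: "\<nu> (n u) d (p v) (A (p v)) \<cdot>\<^bsub>C u\<^esub> i = Idn (C u) (FObj (\<Phi> (w \<otimes> n v) (p v)) (A (p v)))"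
      unfolding i_def by (rule inverse_arr_hom(3)[OF iso partsA(2)])
    have 5: "\<nu> w (n v) (p v) (B (p v)) \<cdot>\<^bsub>C u\<^esub> FArr (\<Phi> w v) (FArr (\<Phi> (n v) (p v)) (f (p v)))
        = FArr (\<Phi> (w \<otimes> n v) (p v)) (f (p v)) \<cdot>\<^bsub>C u\<^esub> \<nu> w (n v) (p v) (A (p v))"
      by (rule nu_nat[OF w(1) N(2,4) np(2) HOL.refl w(3) fv])
    have 6: "\<beta> (w, v) \<cdot>\<^bsub>C u\<^esub> FArr (\<Phi> w v) (\<beta> (n v, p v))
        = \<beta> (w \<otimes> n v, p v) \<cdot>\<^bsub>C u\<^esub> \<nu> w (n v) (p v) (B (p v))"
      by (rule glue_obj_assoc[OF Y _ w(1) N(2,4) np(2) w(2) HOL.refl w(3) u]) simp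
    show ?thesis
      unfolding shriek_map_def d_def[symmetric] i_def[symmetric]
        Phi_cmp[OF w parts[OF w(2)]]
      by (simp add: arr_simps square_extend[OF 1] square_extend[OF 2] square_extend[OF 3]
          retract_extend[OF 4] square_extend[OF 6] 5)
  qed
  show ?thesis
    using j_shriek_obj_closed[OF X] Y hom sq
    unfolding j_shriek_obj_eq by (auto simp: glue_arrows_def glue_index_def)
qed

lemma j_res_bij:
  assumes "X \<in> Obj glueP" "Y \<in> Obj glueW"
  shows "bij_betw (FArr (j_res W P)) (Hom glueW (FObj (j_shriek W S C \<Phi> \<nu> P) X) Y)
    (Hom glueP X (FObj (j_res W P) Y))"
proof -
  obtain A \<alpha> B \<beta> where XY: "X = (A, \<alpha>)" "Y = (B, \<beta>)"
    by (cases X, cases Y) simp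
  have X: "(A, \<alpha>) \<in> glue_objects W C \<Phi> \<nu> P" and Y: "(B, \<beta>) \<in> glue_objects W C \<Phi> \<nu> (carrier W)"
    using assms XY by simp_all
  let ?L = "j_shriek_obj W S C \<Phi> \<nu> P (A, \<alpha>)" and ?R = "j_res_obj W P (B, \<beta>)"
  have res: "FArr (j_res W P) (?L, (B, \<beta>), h) = ((A, \<alpha>), ?R, restrict h P)" for h
    by (simp add: j_res_def j_res_shriek_obj[OF X])
  show ?thesis
    unfolding bij_betw_def
  proof (intro conjI inj_onI equalityI subsetI)
    fix h h' assume "h \<in> Hom glueW (FObj (j_shriek W S C \<Phi> \<nu> P) X) Y"
      and "h' \<in> Hom glueW (FObj (j_shriek W S C \<Phi> \<nu> P) X) Y"
      and eq: "FArr (j_res W P) h = FArr (j_res W P) h'"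
    then obtain g g' where g: "h = (?L, (B, \<beta>), g)" "(?L, (B, \<beta>), g) \<in> glue_arrows W C \<Phi> \<nu> (carrier W)"
      and g': "h' = (?L, (B, \<beta>), g')" "(?L, (B, \<beta>), g') \<in> glue_arrows W C \<Phi> \<nu> (carrier W)"
      by (auto simp: glue_hom_iff XY j_shriek_def)
    have "restrict g P = restrict g' P"
      using eq by (simp add: g(1) g'(1) res)
    then have "g (p w) = g' (p w)" if "w \<in> carrier W" for w
      using p_in[OF that] by (metis restrict_apply')
    then have "g w = g' w" if "w \<in> carrier W" for w
      using that shriek_hom_component[OF X g(2)] shriek_hom_component[OF X g'(2)] by simp
    moreover have "g \<in> extensional (carrier W)" "g' \<in> extensional (carrier W)"
      using g(2) g'(2) by (auto simp: glue_arrows_def)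
    ultimately show "h = h'"
      by (auto simp: g(1) g'(1) intro: extensionalityI)
  next
    fix k assume "k \<in> FArr (j_res W P) ` Hom glueW (FObj (j_shriek W S C \<Phi> \<nu> P) X) Y"
    then obtain h where h: "k = FArr (j_res W P) (?L, (B, \<beta>), h)" "(?L, (B, \<beta>), h) \<in> glue_arrows W C \<Phi> \<nu> (carrier W)"
      by (auto simp: glue_hom_iff XY j_shriek_def)
    have "(?L, (B, \<beta>), h) \<in> Hom glueW ?L (B, \<beta>)"
      using h by (simp add: glue_hom_iff)
    from is_functor.arr_closed[OF j_res_functor[OF P_sub] this]
    show "k \<in> Hom glueP X (FObj (j_res W P) Y)"
      using h by (simp add: XY j_res_def j_res_shriek_obj[OF X])
  next
    fix k assume "k \<in> Hom glueP X (FObj (j_res W P) Y)"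
    then obtain f where f: "k = ((A, \<alpha>), ?R, f)" "((A, \<alpha>), ?R, f) \<in> glue_arrows W C \<Phi> \<nu> P"
      by (auto simp: glue_hom_iff XY j_res_def)
    \<comment> \<open>By \<open>shriek_hom_component\<close> this is the only possible preimage.\<close>
    define h where "h = (\<lambda>w\<in>carrier W. \<beta> (n w, p w) \<cdot>\<^bsub>C w\<^esub> FArr (\<Phi> (n w) (p w)) (f (p w)))"
    have h: "(?L, (B, \<beta>), h) \<in> Hom glueW (FObj (j_shriek W S C \<Phi> \<nu> P) X) Y"
      using extend_hom[OF X Y f(2)] by (simp add: h_def glue_hom_iff XY j_shriek_def)
    have "h w = f w" if w: "w \<in> P" for w
    proof -
      have fw: "f w \<in> Hom (C w) (A w) (B w)"
        using f(2) w by (auto simp: glue_arrows_def j_res_obj_def)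
      have c: "w \<in> carrier W" using w by simp
      show ?thesis
        using category.cmp_idn_left[OF category_C[OF c] fw] HomD[OF fw] w
        by (simp add: h_def n_one p_id Phi_one_arr glue_obj_one[OF Y])
    qed
    moreover have "f \<in> extensional P"
      using f(2) by (auto simp: glue_arrows_def)
    ultimately have "k = FArr (j_res W P) (?L, (B, \<beta>), h)"
      unfolding f(1) res by (auto intro!: extensionalityI[where A = P])
    then show "k \<in> FArr (j_res W P) ` Hom glueW (FObj (j_shriek W S C \<Phi> \<nu> P) X) Y"
      using h by blast
  qed
qed

theorem j_shriek_left_adjoint: "left_adjoint glueP glueW (j_shriek W S C \<Phi> \<nu> P) (j_res W P)"
  unfolding left_adjoint_def
proof (intro conjI exI[of _ "\<lambda>X Y. FArr (j_res W P)"] ballI)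
  interpret F: is_functor glueP glueW "j_shriek W S C \<Phi> \<nu> P" by (rule j_shriek_functor)
  interpret G: is_functor glueW glueP "j_res W P" by (rule j_res_functor[OF P_sub])
  show "is_functor glueP glueW (j_shriek W S C \<Phi> \<nu> P)" "is_functor glueW glueP (j_res W P)"
    by (rule F.is_functor_axioms, rule G.is_functor_axioms)
  fix X X' Y Y' f g h
  assume f: "f \<in> Hom glueP X' X" and g: "g \<in> Hom glueW Y Y'"
    and h: "h \<in> Hom glueW (FObj (j_shriek W S C \<Phi> \<nu> P) X) Y"
  have Ff: "FArr (j_shriek W S C \<Phi> \<nu> P) f
      \<in> Hom glueW (FObj (j_shriek W S C \<Phi> \<nu> P) X') (FObj (j_shriek W S C \<Phi> \<nu> P) X)"
    by (rule F.arr_closed[OF f])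
  show "FArr (j_res W P) (g \<cdot>\<^bsub>glueW\<^esub> h \<cdot>\<^bsub>glueW\<^esub> FArr (j_shriek W S C \<Phi> \<nu> P) f)
      = FArr (j_res W P) g \<cdot>\<^bsub>glueP\<^esub> FArr (j_res W P) h \<cdot>\<^bsub>glueP\<^esub> f"
    by (simp only: G.map_cmp[OF Ff category.cmp_closed[OF glue_category[OF subset_refl] h g]] G.map_cmp[OF h g] j_res_shriek_arr[OF f])
qed (rule j_res_bij)

end

theorem proposition7p1p1:
  fixes W :: "('w, 'r) monoid_scheme" and S :: "'w set"
    and C :: "'w \<Rightarrow> ('o, 'a) cat_data"
    and \<Phi> :: "'w \<Rightarrow> 'w \<Rightarrow> ('o, 'a, 'o, 'a) functor_data"
    and \<nu> :: "'w \<Rightarrow> 'w \<Rightarrow> 'w \<Rightarrow> 'o \<Rightarrow> 'a"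
    and J :: "'w set" and x :: 'w
  assumes "coxeter_system W S" and "finite (carrier W)"
    and "\<And>w. w \<in> carrier W \<Longrightarrow> abelian_category (C w)"
    and "gluing_data W S C \<Phi> \<nu>"
    and "J \<subseteq> S" and "x \<in> carrier W"
  shows "left_adjoint
    (glue_cat W C \<Phi> \<nu> (generate W J #>\<^bsub>W\<^esub> x)) (glue_cat W C \<Phi> \<nu> (carrier W))
    (j_shriek W S C \<Phi> \<nu> (generate W J #>\<^bsub>W\<^esub> x)) (j_res W (generate W J #>\<^bsub>W\<^esub> x))"
proof -
  interpret parabolic_coset W S J x
    using assms(1,5,6) by (simp add: parabolic_coset_def parabolic_coset_axioms_def)
  interpret gluing_data W S C \<Phi> \<nu>
    by (rule assms(4))
  have "coset_extension W S C \<Phi> \<nu> P"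
  proof
    fix u v A
    assume u: "u \<in> carrier W" and v: "v \<in> P" and A: "A \<in> Obj (C v)"
    let ?n = "coset_n W S P u" and ?d = "coset_p W S P u \<otimes>\<^bsub>W\<^esub> inv\<^bsub>W\<^esub> v"
    have car: "coset_p W S P u \<in> carrier W" "v \<in> carrier W"
      using P_carrier coset_p_in u v by auto
    then have "?n \<otimes>\<^bsub>W\<^esub> ?d \<otimes>\<^bsub>W\<^esub> v = u"
      using u m_assoc[of "inv\<^bsub>W\<^esub> (coset_p W S P u)" "coset_p W S P u" "inv\<^bsub>W\<^esub> v"]
      by (simp add: coset_n_def m_assoc)
    moreover have "cox_length W S (?n \<otimes>\<^bsub>W\<^esub> ?d) = cox_length W S ?n + cox_length W S ?d"
      using u v by (intro length_coset_n P_quotient coset_p_in)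
    ultimately show "is_iso (C u) (\<nu> ?n ?d v A)"
      using nu_iso[of ?n ?d v A] u car A by (simp add: coset_n_def)
  qed (auto simp: coset_p_in coset_p_id intro: P_carrier)
  then show ?thesis
    by (rule coset_extension.j_shriek_left_adjoint)
qed

end
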